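(* Let $k\ge0$ be an integer, regard $n$ as an indeterminate, and let $G_{kn}$ be the Gram matrix associated to $O_n^*$. Then $$\det(G_{kn})=\prod_{|\lambda|=k/2}f_n(\lambda)^{(f^\lambda)^2},\qquad f_n(\lambda)=\prod_{(i,j)\in\lambda}(n+j-i),$$ where the product is over all Young diagrams $\lambda$ with $k/2$ boxes (an empty product, equal to $1$, if $k$ is odd).
   Context: Let $\mathcal P_o^*(k)$ be the set of pairings of $\{1,\dots,k\}$ (set partitions with all blocks of size 2) such that each block consists of one odd number and one even number. The Gram matrix associated to the half-liberated orthogonal quantum group $O_n^*$ is $G_{kn}=(n^{|\pi\vee\sigma|})_{\pi,\sigma\in\mathcal P_o^*(k)}$, where $\pi\vee\sigma$ is the join in the lattice of all set partitions of $\{1,\dots,k\}$ and $|\cdot|$ is the number of blocks; the determinant of an empty matrix is $1$. For a Young diagram $\lambda$, $|\lambda|$ is its number of boxes, $(i,j)\in\lambda$ means the box in row $i$ and column $j$ (starting from $1$), and $f^\lambda$ is the number of standard Young tableaux of shape $\lambda$. *)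

theory Defs
  imports
    "HOL-Library.Disjoint_Sets"
    "HOL-Library.FuncSet"
    "HOL-Algebra.Lattice"
    "HOL-Computational_Algebra.Polynomial"
    "Jordan_Normal_Form.Determinant"
begin

section \<open>The lattice of set partitions\<close>

text \<open>Set partitions ordered by refinement, the finer partition being the smaller one.\<close>

definition partition_lattice :: "'a set \<Rightarrow> 'a set set gorder" where
  "partition_lattice A = \<lparr>carrier = {P. partition_on A P}, eq = (=), le = refines A\<rparr>"

lemma partition_lattice_simps [simp]:
  "carrier (partition_lattice A) = {P. partition_on A P}"
  "eq (partition_lattice A) = (=)"
  "le (partition_lattice A) = refines A"
  by (simp_all add: partition_lattice_def)

lemma partial_order_partition_lattice: "partial_order (partition_lattice A)"
proof
  fix x y z :: "'a set set"
  show "\<lbrakk>x \<sqsubseteq>\<^bsub>partition_lattice A\<^esub> y; y \<sqsubseteq>\<^bsub>partition_lattice A\<^esub> z\<rbrakk> \<Longrightarrow> x \<sqsubseteq>\<^bsub>partition_lattice A\<^esub> z"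
    by (auto intro: refines_trans)
qed (auto intro: refines_refl dest: refines_asym)

lemma lattice_partition_lattice: "lattice (partition_lattice A)"
proof -
  let ?L = "partition_lattice A"
  interpret L: partial_order ?L by (rule partial_order_partition_lattice)
  show ?thesis
  proof
    fix P Q assume "P \<in> carrier ?L" "Q \<in> carrier ?L"
    then have P: "partition_on A P" and Q: "partition_on A Q" by auto
    define U where "U = {R. refines A P R \<and> refines A Q R}"
    have U: "R \<in> U \<Longrightarrow> partition_on A R" for R by (auto simp: U_def refines_def)
    have "partition_on A ({A} - {{}})" by (auto simp: partition_on_def disjoint_def)
    moreover have "\<exists>Y\<in>{A} - {{}}. X \<subseteq> Y" if "partition_on A R" "X \<in> R" for R X
    proof -
      have "X \<noteq> {}" "X \<subseteq> A" using that by (auto simp: partition_on_def)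
      then show ?thesis by auto
    qed
    ultimately have "{A} - {{}} \<in> U"
      using P Q unfolding U_def refines_def by blast
    then have ne: "U \<noteq> {}" by auto
    have "partition_on A (common_refinement U)"
      using partition_on_common_refinement[OF U ne] .
    moreover have "refines A P (common_refinement U)"
      using U P ne by (intro common_refinement_coarsest) (auto simp: U_def)
    moreover have "refines A Q (common_refinement U)"
      using U Q ne by (intro common_refinement_coarsest) (auto simp: U_def)
    moreover have "refines A (common_refinement U) R" if "refines A P R" "refines A Q R" for R
      using that by (intro refines_common_refinement U) (auto simp: U_def)
    ultimately have "least ?L (common_refinement U) (Upper ?L {P, Q})"
      using P Q by (simp add: least_def Upper_def subset_iff)
    then show "\<exists>s. least ?L s (Upper ?L {P, Q})" by blast
    have V: "R \<in> {P, Q} \<Longrightarrow> partition_on A R" for R using P Q by auto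
    have "partition_on A (common_refinement {P, Q})"
      by (rule partition_on_common_refinement[OF V]) auto
    moreover have "refines A (common_refinement {P, Q}) P" "refines A (common_refinement {P, Q}) Q"
      by (rule refines_common_refinement[OF V]; simp)+
    moreover have "refines A R (common_refinement {P, Q})" if "refines A R P" "refines A R Q" for R
      using that V by (intro common_refinement_coarsest) (auto simp: refines_def)
    ultimately have "greatest ?L (common_refinement {P, Q}) (Lower ?L {P, Q})"
      using P Q by (simp add: greatest_def Lower_def subset_iff)
    then show "\<exists>s. greatest ?L s (Lower ?L {P, Q})" by blast
  qed
qed

definition odd_even_pairings :: "nat \<Rightarrow> nat set set set" where
  "odd_even_pairings k =
     {P. partition_on {1..k} P \<and> (\<forall>B\<in>P. \<exists>a b. B = {a, b} \<and> odd a \<and> even b)}"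

lemma finite_odd_even_pairings: "finite (odd_even_pairings k)"
  by (rule finite_subset[OF _ finitely_many_partition_on[of "{1..k}"]])
    (auto simp: odd_even_pairings_def)

text \<open>
  The index set of the Gram matrix carries no canonical order, so the matrix is formed along a
  list \<open>ps\<close> enumerating it. A result about \<open>half_liberated_gram\<close> is to be stated
  for every repetition-free enumeration \<open>ps\<close> of \<open>odd_even_pairings k\<close>.
\<close>

definition half_liberated_gram ::
    "nat \<Rightarrow> 'a::comm_ring_1 \<Rightarrow> nat set set list \<Rightarrow> 'a mat" where
  "half_liberated_gram k n ps =
     mat (length ps) (length ps)
       (\<lambda>(i, j). n ^ card (join (partition_lattice {1..k}) (ps ! i) (ps ! j)))"

section \<open>Young diagrams\<close>

text \<open>A box is a pair (row, column), both counted from 1.\<close>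

definition young_diagram :: "(nat \<times> nat) set \<Rightarrow> bool" where
  "young_diagram \<mu> \<longleftrightarrow> finite \<mu> \<and>
     (\<forall>(i, j)\<in>\<mu>. 1 \<le> i \<and> 1 \<le> j \<and> {1..i} \<times> {1..j} \<subseteq> \<mu>)"

lemma finite_young_diagrams: "finite {\<mu>. young_diagram \<mu> \<and> card \<mu> = m}"
proof (rule finite_subset)
  show "{\<mu>. young_diagram \<mu> \<and> card \<mu> = m} \<subseteq> Pow ({1..m} \<times> {1..m})"
  proof (clarsimp simp: young_diagram_def)
    fix \<mu> :: "(nat \<times> nat) set" and i j
    assume fin: "finite \<mu>" and "(i, j) \<in> \<mu>" and
      "\<forall>(i, j)\<in>\<mu>. Suc 0 \<le> i \<and> Suc 0 \<le> j \<and> {Suc 0..i} \<times> {Suc 0..j} \<subseteq> \<mu>"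
    then have 1: "1 \<le> i" "1 \<le> j" and sub: "{1..i} \<times> {1..j} \<subseteq> \<mu>" by auto
    have "i * j \<le> card \<mu>" using card_mono[OF fin sub] by (simp add: card_cartesian_product)
    moreover have "i \<le> i * j" "j \<le> i * j" using 1 by auto
    ultimately show "Suc 0 \<le> i \<and> i \<le> card \<mu> \<and> Suc 0 \<le> j \<and> j \<le> card \<mu>"
      using 1 by linarith
  qed
qed simp

definition standard_tableaux :: "(nat \<times> nat) set \<Rightarrow> (nat \<times> nat \<Rightarrow> nat) set" where
  "standard_tableaux \<mu> = {T \<in> \<mu> \<rightarrow>\<^sub>E {1..card \<mu>}. bij_betw T \<mu> {1..card \<mu>} \<and>
     (\<forall>i j j'. (i, j) \<in> \<mu> \<and> (i, j') \<in> \<mu> \<and> j < j' \<longrightarrow> T (i, j) < T (i, j')) \<and>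
     (\<forall>i i' j. (i, j) \<in> \<mu> \<and> (i', j) \<in> \<mu> \<and> i < i' \<longrightarrow> T (i, j) < T (i', j))}"

definition num_standard_tableaux :: "(nat \<times> nat) set \<Rightarrow> nat" where
  "num_standard_tableaux \<mu> = card (standard_tableaux \<mu>)"

definition content_product :: "'a::comm_ring_1 \<Rightarrow> (nat \<times> nat) set \<Rightarrow> 'a" where
  "content_product n \<mu> = (\<Prod>(i, j)\<in>\<mu>. n + of_nat j - of_nat i)"

end

theory Submission
  imports Defs "HOL-Combinatorics.Permutations"
begin

text \<open>
  Let \<open>k = 2 m\<close>. A pairing of odd with even numbers is the same as a permutation of
  \<open>{1..m}\<close> (\<open>bij_betw_pairing\<close>), and the join of the pairings of \<open>p\<close> and \<open>q\<close> has
  one block for each cycle of \<open>q \<circ> p\<inverse>\<close>. The Gram matrix is therefore the matrix of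
  multiplication by \<open>\<Sum>\<sigma>. n ^ cycles(\<sigma>) \<sigma>\<close> on the group algebra of the symmetric group.
  By a classical observation of Jucys this element factors as the product of the \<open>n + J\<^sub>l\<close>
  for \<open>1 \<le> l \<le> m\<close>, where \<open>J\<^sub>l = \<Sum>\<^bsub>j<l\<^esub> (j l)\<close> are the Jucys--Murphy elements. So the
  determinant can be read off from a basis of common eigenvectors of the \<open>J\<^sub>l\<close>.

  Such a basis is indexed by pairs \<open>(S, T)\<close> of standard tableaux of the same shape with \<open>m\<close>
  boxes. The vector of \<open>(S, T)\<close> is an eigenvector for left multiplication by \<open>J\<^sub>l\<close> with eigenvalue
  the content of the box of \<open>S\<close> with entry \<open>l\<close>, and for right multiplication with the content
  of the box of \<open>T\<close> with entry \<open>l\<close>. On it the product of the \<open>n + J\<^sub>l\<close> is the scalar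
  \<open>f\<^sub>n(\<lambda>)\<close>, and the shape \<open>\<lambda>\<close> occurs \<open>(f\<^sup>\<lambda>)\<^sup>2\<close> times.

  Three facts give the basis.
  \<^item> The vectors exist (\<open>bi_weight_vector_exists\<close>). One pair of tableaux is treated by
    hand: a column antisymmetrizer times a row symmetrizer is an eigenvector by Garnir
    relations if the tableaux are filled column by column and row by row, respectively
    (\<open>garnir_relation\<close>, \<open>bi_weight_vector_reading\<close>). The intertwiners
    \<open>s\<^sub>i - 1 / (c\<^sub>i\<^sub>+\<^sub>1 - c\<^sub>i)\<close>, with \<open>c\<^sub>i\<close> the content of the box of entry \<open>i\<close>, then move from
    a tableau to the one with \<open>i\<close> and \<open>i + 1\<close> exchanged (\<open>has_weight_swap\<close>), and such
    exchanges connect all standard tableaux of one shape (\<open>SYT_connected\<close>).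
  \<^item> They are linearly independent, because a standard tableau is determined by its sequence
    of contents (\<open>SYT_determined_by_contents\<close>), so that any two of the vectors have
    different joint eigenvalues.
  \<^item> Their number is the order of the group, as \<open>\<Sum>\<lambda>. (f\<^sup>\<lambda>)\<^sup>2 = m!\<close>
    (\<open>sum_squares_num_SYT\<close>).

  Cycles and blocks are counted through colourings. It suffices to check the identity of
  polynomials at all natural numbers \<open>N\<close>. The power of \<open>N\<close> to the number of blocks of a
  partition is the number of colourings with \<open>N\<close> colours that are constant on blocks, and a
  function is constant on the blocks of a join if and only if it is constant on the blocks of
  both partitions.
\<close>

section \<open>Corners of Young diagrams\<close>

lemma young_diagram_mono:
  assumes "young_diagram \<mu>" "(i, j) \<in> \<mu>" "1 \<le> i'" "i' \<le> i" "1 \<le> j'" "j' \<le> j"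
  shows "(i', j') \<in> \<mu>"
proof -
  have "{1..i} \<times> {1..j} \<subseteq> \<mu>" using assms(1,2) by (auto simp: young_diagram_def)
  moreover have "(i', j') \<in> {1..i} \<times> {1..j}" using assms by auto
  ultimately show ?thesis by blast
qed

lemma young_diagram_pos:
  assumes "young_diagram \<mu>" "(i, j) \<in> \<mu>"
  shows "1 \<le> i" "1 \<le> j"
  using assms by (auto simp: young_diagram_def)

lemma young_diagram_finite: "young_diagram \<mu> \<Longrightarrow> finite \<mu>"
  by (simp add: young_diagram_def)

lemma young_diagramI:
  assumes "finite \<mu>" "\<And>i j. (i, j) \<in> \<mu> \<Longrightarrow> 1 \<le> i \<and> 1 \<le> j"
    and "\<And>i j i' j'. (i, j) \<in> \<mu> \<Longrightarrow> 1 \<le> i' \<Longrightarrow> i' \<le> i \<Longrightarrow> 1 \<le> j' \<Longrightarrow> j' \<le> j \<Longrightarrow> (i', j') \<in> \<mu>"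
  shows "young_diagram \<mu>"
  unfolding young_diagram_def using assms(1,2) by (auto intro: assms(3))

lemma young_diagram_empty [simp]: "young_diagram {}"
  by (simp add: young_diagram_def)

lemma young_diagram_Int:
  assumes "young_diagram \<mu>" "young_diagram \<nu>"
  shows "young_diagram (\<mu> \<inter> \<nu>)"
  using assms
  by (intro young_diagramI)
    (auto simp: young_diagram_finite dest: young_diagram_pos intro: young_diagram_mono)

lemma young_diagram_Un:
  assumes "young_diagram \<mu>" "young_diagram \<nu>"
  shows "young_diagram (\<mu> \<union> \<nu>)"
  using assms
  by (intro young_diagramI)
    (auto simp: young_diagram_finite dest: young_diagram_pos intro: young_diagram_mono)

definition box_content :: "nat \<times> nat \<Rightarrow> int" where
  "box_content x = int (snd x) - int (fst x)"

definition corners :: "(nat \<times> nat) set \<Rightarrow> (nat \<times> nat) set" where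
  "corners \<mu> = {x \<in> \<mu>. young_diagram (\<mu> - {x})}"

definition addable :: "(nat \<times> nat) set \<Rightarrow> (nat \<times> nat) set" where
  "addable \<mu> = {x. x \<notin> \<mu> \<and> young_diagram (insert x \<mu>)}"

definition row_length :: "(nat \<times> nat) set \<Rightarrow> nat \<Rightarrow> nat" where
  "row_length \<mu> i = card {j. (i, j) \<in> \<mu>}"

lemma mem_iff_row_length:
  assumes "young_diagram \<mu>"
  shows "(i, j) \<in> \<mu> \<longleftrightarrow> 1 \<le> j \<and> j \<le> row_length \<mu> i"
proof -
  let ?R = "{j. (i, j) \<in> \<mu>}"
  have fin: "finite ?R"
    by (rule finite_imageD[of "Pair i", OF finite_subset[OF _ young_diagram_finite[OF assms]]])
      (auto simp: inj_on_def)
  have "?R = {1..row_length \<mu> i}"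
  proof (cases "?R = {}")
    case True
    then show ?thesis by (simp add: row_length_def)
  next
    case False
    define M where "M = Max ?R"
    have M: "(i, M) \<in> \<mu>" using Max_in[OF fin False] by (simp add: M_def)
    have le: "j \<le> M" if "(i, j) \<in> \<mu>" for j using Max_ge[OF fin, of j] that by (simp add: M_def)
    have "(i, j) \<in> \<mu> \<longleftrightarrow> 1 \<le> j \<and> j \<le> M" for j
      using young_diagram_mono[OF assms M, of i j] young_diagram_pos[OF assms, of i j]
        young_diagram_pos[OF assms M] le[of j] by blast
    then have "?R = {1..M}" unfolding set_eq_iff mem_Collect_eq atLeastAtMost_iff by blast
    then show ?thesis by (simp add: row_length_def)
  qed
  then have "j \<in> ?R \<longleftrightarrow> j \<in> {1..row_length \<mu> i}" by (rule arg_cong)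
  then show ?thesis by simp
qed

lemma row_length_antimono:
  assumes "young_diagram \<mu>" "1 \<le> i" "i \<le> i'"
  shows "row_length \<mu> i' \<le> row_length \<mu> i"
proof (cases "row_length \<mu> i' = 0")
  case False
  then have "(i', row_length \<mu> i') \<in> \<mu>" by (simp add: mem_iff_row_length[OF assms(1)])
  then have "(i, row_length \<mu> i') \<in> \<mu>" using assms False by (auto intro: young_diagram_mono)
  then show ?thesis by (simp add: mem_iff_row_length[OF assms(1)])
qed simp

lemma corners_eq:
  assumes "young_diagram \<mu>"
  shows "corners \<mu> = (\<lambda>i. (i, row_length \<mu> i)) ` {i. 1 \<le> i \<and> row_length \<mu> (Suc i) < row_length \<mu> i}"
    (is "_ = ?f ` ?I")
proof (intro subset_antisym subsetI)
  note mem = mem_iff_row_length[OF assms]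
  fix x assume "x \<in> corners \<mu>"
  then obtain i j where x: "x = (i, j)" "(i, j) \<in> \<mu>" and Y: "young_diagram (\<mu> - {(i, j)})"
    by (cases x) (auto simp: corners_def)
  have pos: "1 \<le> i" "1 \<le> j" using young_diagram_pos[OF assms x(2)] .
  have "(i, Suc j) \<notin> \<mu>" using young_diagram_mono[OF Y, of i "Suc j" i j] pos by auto
  then have j: "j = row_length \<mu> i" using x(2) by (auto simp: mem)
  have "(Suc i, j) \<notin> \<mu>" using young_diagram_mono[OF Y, of "Suc i" j i j] pos by auto
  then have "row_length \<mu> (Suc i) < j" using pos by (auto simp: mem)
  then show "x \<in> ?f ` ?I" using x j pos by auto
next
  note mem = mem_iff_row_length[OF assms]
  fix x assume "x \<in> ?f ` ?I"
  then obtain i where x: "x = (i, row_length \<mu> i)" and i: "1 \<le> i" "row_length \<mu> (Suc i) < row_length \<mu> i"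
    by auto
  have "x \<in> \<mu>" using x i by (auto simp: mem)
  moreover have "young_diagram (\<mu> - {x})"
  proof (rule young_diagramI)
    fix a b a' b' assume h: "(a, b) \<in> \<mu> - {x}" "1 \<le> a'" "a' \<le> a" "1 \<le> b'" "b' \<le> b"
    have "(a', b') \<in> \<mu>" using h assms by (auto intro: young_diagram_mono)
    moreover have "(a', b') \<noteq> x"
    proof
      assume e: "(a', b') = x"
      show False
      proof (cases "a = i")
        case True
        then show False using h e x by (auto simp: mem)
      next
        case False
        then have "Suc i \<le> a" using h e x by auto
        then have "row_length \<mu> a \<le> row_length \<mu> (Suc i)" using assms by (auto intro: row_length_antimono)
        then show False using h e x i by (auto simp: mem)
      qed
    qed
    ultimately show "(a', b') \<in> \<mu> - {x}" by blast
  qed (use assms in \<open>auto dest: young_diagram_pos young_diagram_finite\<close>)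
  ultimately show "x \<in> corners \<mu>" by (simp add: corners_def)
qed

lemma addable_eq:
  assumes "young_diagram \<mu>"
  shows "addable \<mu> = (\<lambda>i. (i, Suc (row_length \<mu> i))) `
    insert 1 (Suc ` {i. 1 \<le> i \<and> row_length \<mu> (Suc i) < row_length \<mu> i})" (is "_ = ?f ` ?I")
proof (intro subset_antisym subsetI)
  note mem = mem_iff_row_length[OF assms]
  fix x assume "x \<in> addable \<mu>"
  then obtain i j where x: "x = (i, j)" "(i, j) \<notin> \<mu>" and Y: "young_diagram (insert (i, j) \<mu>)"
    by (cases x) (auto simp: addable_def)
  have pos: "1 \<le> i" "1 \<le> j" using young_diagram_pos[OF Y, of i j] by auto
  have "j = Suc (row_length \<mu> i)"
  proof -
    have "row_length \<mu> i < j" using x pos by (auto simp: mem)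
    moreover have "j - 1 \<le> row_length \<mu> i"
    proof (cases "j = 1")
      case False
      then have "1 \<le> j - 1" "j - 1 \<noteq> j" using pos by auto
      then show ?thesis using young_diagram_mono[OF Y, of i j i "j - 1"] pos by (auto simp: mem)
    qed simp
    ultimately show ?thesis by auto
  qed
  moreover have "i \<in> ?I"
  proof (cases "i = 1")
    case False
    then have "1 \<le> i - 1" "i - 1 \<noteq> i" using pos by auto
    then have "(i - 1, j) \<in> \<mu>" using young_diagram_mono[OF Y, of i j "i - 1" j] pos by auto
    moreover have "i = Suc (i - 1)" using pos by simp
    ultimately show ?thesis using x pos False by (auto simp: mem image_iff intro!: exI[of _ "i - 1"])
  qed simp
  ultimately show "x \<in> ?f ` ?I" using x by auto
next
  note mem = mem_iff_row_length[OF assms]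
  fix x assume "x \<in> ?f ` ?I"
  then obtain i where x: "x = (i, Suc (row_length \<mu> i))" and i: "i \<in> ?I" by auto
  have i1: "1 \<le> i" using i by auto
  have "x \<notin> \<mu>" using x by (auto simp: mem)
  moreover have "young_diagram (insert x \<mu>)"
  proof (rule young_diagramI)
    fix a b a' b' assume h: "(a, b) \<in> insert x \<mu>" "1 \<le> a'" "a' \<le> a" "1 \<le> b'" "b' \<le> b"
    show "(a', b') \<in> insert x \<mu>"
    proof (cases "(a, b) = x")
      case False
      then show ?thesis using h assms by (auto intro: young_diagram_mono)
    next
      case True
      show ?thesis
      proof (cases "a' = i")
        case True
        then show ?thesis using h \<open>(a, b) = x\<close> x by (auto simp: mem)
      next
        case False
        then have l: "a' < i" using h True x by auto
        then have "row_length \<mu> i < row_length \<mu> (i - 1)" "a' \<le> i - 1" using i h by auto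
        then have "Suc (row_length \<mu> i) \<le> row_length \<mu> a'"
          using row_length_antimono[OF assms, of a' "i - 1"] h by linarith
        then show ?thesis using h True x by (auto simp: mem)
      qed
    qed
  qed (use assms x i1 in \<open>auto dest: young_diagram_pos young_diagram_finite\<close>)
  ultimately show "x \<in> addable \<mu>" by (simp add: addable_def)
qed

lemma finite_corners: "young_diagram \<mu> \<Longrightarrow> finite (corners \<mu>)"
  by (rule finite_subset[of _ \<mu>]) (auto simp: corners_def young_diagram_finite)

text \<open>
  Listed by rows, corners and addable boxes alternate along the boundary: row \<open>i\<close> ends in a
  corner if and only if a box can be added to row \<open>i + 1\<close>, and a box can always be added to
  the first row.
\<close>

lemma card_addable:
  assumes "young_diagram \<mu>"
  shows "finite (addable \<mu>)" "card (addable \<mu>) = Suc (card (corners \<mu>))"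
proof -
  define I where "I = {i. 1 \<le> i \<and> row_length \<mu> (Suc i) < row_length \<mu> i}"
  have inj: "inj_on (\<lambda>i. (i, f i)) X" for f :: "nat \<Rightarrow> nat" and X
    by (auto simp: inj_on_def)
  have c: "corners \<mu> = (\<lambda>i. (i, row_length \<mu> i)) ` I"
    using corners_eq[OF assms] by (simp add: I_def)
  have a: "addable \<mu> = (\<lambda>i. (i, Suc (row_length \<mu> i))) ` insert 1 (Suc ` I)"
    using addable_eq[OF assms] by (simp add: I_def)
  have fin: "finite I" using finite_corners[OF assms] c finite_image_iff[OF inj] by metis
  then show "finite (addable \<mu>)" by (simp add: a)
  have "card (addable \<mu>) = card (insert 1 (Suc ` I))" unfolding a by (rule card_image[OF inj])
  also have "\<dots> = Suc (card I)"
    using fin by (subst card_insert_disjoint) (auto simp: card_image I_def)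
  also have "card I = card (corners \<mu>)" unfolding c by (rule card_image[OF inj, symmetric])
  finally show "card (addable \<mu>) = Suc (card (corners \<mu>))" .
qed

lemma addable_Diff_corner:
  assumes "young_diagram \<mu>" "y \<in> corners \<mu>"
  shows "y \<in> addable (\<mu> - {y})" "insert y (\<mu> - {y}) = \<mu>"
  using assms by (auto simp: addable_def corners_def insert_absorb)

text \<open>
  Two different boxes of equal content lie on a diagonal, one strictly below and to the right
  of the other, so the first would have to be present before the second can be added.
\<close>

lemma addable_content_inj:
  assumes "x \<in> addable \<mu>" "y \<in> addable \<mu>" "box_content x = box_content y"
  shows "x = y"
proof -
  have *: "fst x \<ge> fst y" if "x \<in> addable \<mu>" "y \<in> addable \<mu>" "box_content x = box_content y" for x y
  proof (rule ccontr)
    assume "\<not> fst x \<ge> fst y"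
    moreover obtain i j i' j' where [simp]: "x = (i, j)" "y = (i', j')" by fastforce
    ultimately have l: "i < i'" "j < j'" using that(3) by (auto simp: box_content_def)
    have X: "x \<notin> \<mu>" and Y: "young_diagram (insert y \<mu>)" and Z: "young_diagram (insert x \<mu>)"
      using that by (auto simp: addable_def)
    have "1 \<le> i" "1 \<le> j" using young_diagram_pos[OF Z, of i j] by auto
    then have "x \<in> insert y \<mu>" using young_diagram_mono[OF Y, of i' j' i j] l by auto
    then show False using X l by auto
  qed
  have "fst x = fst y" using *[of x y] *[of y x] assms by auto
  then show ?thesis using assms(3) by (cases x; cases y) (auto simp: box_content_def)
qed

section \<open>Counting standard tableaux\<close>

abbreviation SYT :: "(nat \<times> nat) set \<Rightarrow> (nat \<times> nat \<Rightarrow> nat) set" where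
  "SYT \<equiv> standard_tableaux"

lemma SYT_bij: "T \<in> SYT \<mu> \<Longrightarrow> bij_betw T \<mu> {1..card \<mu>}"
  by (simp add: standard_tableaux_def)

lemma SYT_range: "T \<in> SYT \<mu> \<Longrightarrow> x \<in> \<mu> \<Longrightarrow> 1 \<le> T x \<and> T x \<le> card \<mu>"
  using SYT_bij[of T \<mu>] by (auto dest!: bij_betwE)

lemma SYT_inj: "T \<in> SYT \<mu> \<Longrightarrow> x \<in> \<mu> \<Longrightarrow> y \<in> \<mu> \<Longrightarrow> T x = T y \<longleftrightarrow> x = y"
  using SYT_bij[of T \<mu>] by (auto simp: bij_betw_def inj_on_def)

lemma SYT_surj:
  assumes "T \<in> SYT \<mu>" "1 \<le> i" "i \<le> card \<mu>"
  obtains x where "x \<in> \<mu>" "T x = i"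
proof -
  have "i \<in> T ` \<mu>" using SYT_bij[OF assms(1)] assms by (auto simp: bij_betw_def)
  then show thesis using that by auto
qed

lemma SYT_row: "T \<in> SYT \<mu> \<Longrightarrow> (i, j) \<in> \<mu> \<Longrightarrow> (i, j') \<in> \<mu> \<Longrightarrow> j < j' \<Longrightarrow> T (i, j) < T (i, j')"
  unfolding standard_tableaux_def by blast

lemma SYT_column: "T \<in> SYT \<mu> \<Longrightarrow> (i, j) \<in> \<mu> \<Longrightarrow> (i', j) \<in> \<mu> \<Longrightarrow> i < i' \<Longrightarrow> T (i, j) < T (i', j)"
  unfolding standard_tableaux_def by blast

lemma SYT_mono:
  assumes "young_diagram \<mu>" "T \<in> SYT \<mu>" "(i, j) \<in> \<mu>" "(i', j') \<in> \<mu>" "i \<le> i'" "j \<le> j'"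
  shows "T (i, j) \<le> T (i', j')"
proof -
  have "1 \<le> i" "1 \<le> j" using young_diagram_pos[OF assms(1,3)] .
  then have m: "(i, j') \<in> \<mu>" using assms by (auto intro: young_diagram_mono[OF assms(1,4)])
  have "T (i, j) \<le> T (i, j')" using SYT_row[OF assms(2,3) m] assms by (cases "j = j'") auto
  also have "\<dots> \<le> T (i', j')" using SYT_column[OF assms(2) m assms(4)] assms by (cases "i = i'") auto
  finally show ?thesis .
qed

lemma SYT_outside: "T \<in> SYT \<mu> \<Longrightarrow> x \<notin> \<mu> \<Longrightarrow> T x = undefined"
  unfolding standard_tableaux_def by (cases x) (auto simp: PiE_iff extensional_def)

lemma SYT_empty: "SYT {} = {\<lambda>x. undefined}"
  by (auto simp: standard_tableaux_def bij_betw_def)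

lemma finite_SYT: "young_diagram \<mu> \<Longrightarrow> finite (SYT \<mu>)"
  by (rule finite_subset[of _ "\<mu> \<rightarrow>\<^sub>E {1..card \<mu>}"])
    (auto simp: standard_tableaux_def young_diagram_finite intro!: finite_PiE)

lemma SYT_extend:
  assumes Y: "young_diagram \<mu>" and x: "x \<in> addable \<mu>" and T: "T \<in> SYT \<mu>"
  shows "T(x := Suc (card \<mu>)) \<in> SYT (insert x \<mu>)"
proof -
  let ?T = "T(x := Suc (card \<mu>))"
  have xn: "x \<notin> \<mu>" and Y': "young_diagram (insert x \<mu>)" using x by (auto simp: addable_def)
  have c: "card (insert x \<mu>) = Suc (card \<mu>)"
    using xn young_diagram_finite[OF Y] by simp
  have ext: "?T \<in> insert x \<mu> \<rightarrow>\<^sub>E {1..card (insert x \<mu>)}"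
    using T xn unfolding c standard_tableaux_def by (auto simp: PiE_iff extensional_def)
  have "bij_betw ?T \<mu> {1..card \<mu>}"
    using SYT_bij[OF T] xn by (subst bij_betw_cong[of _ _ T]) auto
  then have "bij_betw ?T (insert x \<mu>) (insert (Suc (card \<mu>)) {1..card \<mu>})"
    using xn by (auto simp: bij_betw_def image_iff dest: inj_onD)
  then have bij: "bij_betw ?T (insert x \<mu>) {1..card (insert x \<mu>)}"
    by (simp add: c atLeastAtMostSuc_conv)
  have last: "?T a < ?T b"
    if "a \<in> insert x \<mu>" "b \<in> insert x \<mu>" "a \<noteq> b" "fst a \<le> fst b" "snd a \<le> snd b"
      "a \<in> \<mu> \<Longrightarrow> b \<in> \<mu> \<Longrightarrow> T a < T b" for a b
  proof -
    have "a \<noteq> x"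
    proof
      assume "a = x"
      then have "b \<in> \<mu>" using that by auto
      moreover have "1 \<le> fst a" "1 \<le> snd a" using young_diagram_pos[OF Y', of "fst a" "snd a"] that by auto
      ultimately have "a \<in> \<mu>" using young_diagram_mono[OF Y, of "fst b" "snd b" "fst a" "snd a"] that by auto
      then show False using \<open>a = x\<close> xn by simp
    qed
    then show ?thesis using that SYT_range[OF T, of a] by auto
  qed
  show ?thesis
    unfolding standard_tableaux_def mem_Collect_eq
  proof (intro conjI allI impI ext bij; elim conjE)
    fix i j j' assume "(i, j) \<in> insert x \<mu>" "(i, j') \<in> insert x \<mu>" "j < j'"
    then show "?T (i, j) < ?T (i, j')" by (intro last SYT_row[OF T]) simp_all
  next
    fix i i' j assume "(i, j) \<in> insert x \<mu>" "(i', j) \<in> insert x \<mu>" "i < i'"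
    then show "?T (i, j) < ?T (i', j)" by (intro last SYT_column[OF T]) simp_all
  qed
qed

text \<open>
  Tableaux are \<open>undefined\<close> outside their shape, which makes removal of the largest entry a
  restriction and its addition a function update.
\<close>

lemma SYT_restrict:
  assumes fin: "finite \<mu>" and x: "x \<notin> \<mu>" and T: "T \<in> SYT (insert x \<mu>)" and Tx: "T x = Suc (card \<mu>)"
  shows "restrict T \<mu> \<in> SYT \<mu>" "(restrict T \<mu>)(x := Suc (card \<mu>)) = T"
proof -
  have c: "card (insert x \<mu>) = Suc (card \<mu>)" using x fin by simp
  have b: "bij_betw T (insert x \<mu>) (insert (Suc (card \<mu>)) {1..card \<mu>})"
    using SYT_bij[OF T] by (simp add: c atLeastAtMostSuc_conv)
  have "bij_betw T \<mu> {1..card \<mu>}"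
    using notIn_Un_bij_betw3[of x \<mu> T "{1..card \<mu>}"] b x Tx by simp
  then have b': "bij_betw (restrict T \<mu>) \<mu> {1..card \<mu>}"
    by (subst bij_betw_cong[of _ _ T]) auto
  then have "restrict T \<mu> \<in> \<mu> \<rightarrow>\<^sub>E {1..card \<mu>}"
    by (intro restrict_PiE_iff[THEN iffD2] ballI PiE_I) (auto dest: bij_betwE)
  then show "restrict T \<mu> \<in> SYT \<mu>"
    unfolding standard_tableaux_def using b'
    by (auto intro!: SYT_row[OF T] SYT_column[OF T])
  have "T z = undefined" if "z \<notin> insert x \<mu>" for z
    using SYT_outside[OF T that] .
  then show "(restrict T \<mu>)(x := Suc (card \<mu>)) = T"
    using Tx by (auto simp: fun_eq_iff)
qed

lemma SYT_last_corner:
  assumes Y: "young_diagram \<mu>" and T: "T \<in> SYT \<mu>" and x: "x \<in> \<mu>" "T x = card \<mu>"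
  shows "x \<in> corners \<mu>"
proof -
  have "young_diagram (\<mu> - {x})"
  proof (rule young_diagramI)
    fix a b a' b' assume h: "(a, b) \<in> \<mu> - {x}" "1 \<le> a'" "a' \<le> a" "1 \<le> b'" "b' \<le> b"
    then have m: "(a', b') \<in> \<mu>" using Y by (auto intro: young_diagram_mono)
    have "T (a', b') \<le> T (a, b)" using h m SYT_mono[OF Y T m] by auto
    moreover have "T (a, b) \<noteq> T x" using SYT_inj[OF T, of "(a, b)" x] h x by auto
    moreover have "T (a, b) \<le> T x" using SYT_range[OF T, of "(a, b)"] h x by auto
    ultimately have "(a', b') \<noteq> x" by auto
    with m show "(a', b') \<in> \<mu> - {x}" by simp
  qed (use Y in \<open>auto dest: young_diagram_pos young_diagram_finite\<close>)
  then show ?thesis using x by (simp add: corners_def)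
qed

lemma SYT_decompose:
  assumes Y: "young_diagram \<mu>" and ne: "\<mu> \<noteq> {}" and T: "T \<in> SYT \<mu>"
  obtains x T' where "x \<in> corners \<mu>" "T' \<in> SYT (\<mu> - {x})" "T = T'(x := card \<mu>)"
    "T x = card \<mu>" "T' = restrict T (\<mu> - {x})"
proof -
  have "1 \<le> card \<mu>" using ne young_diagram_finite[OF Y] by (simp add: Suc_leI card_gt_0_iff)
  then obtain x where x: "x \<in> \<mu>" "T x = card \<mu>" using SYT_surj[OF T] by auto
  have i: "insert x (\<mu> - {x}) = \<mu>" using x by auto
  have c: "card \<mu> = Suc (card (\<mu> - {x}))"
    using card_Suc_Diff1[OF young_diagram_finite[OF Y] x(1)] by simp
  have r: "restrict T (\<mu> - {x}) \<in> SYT (\<mu> - {x})"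
    "(restrict T (\<mu> - {x}))(x := Suc (card (\<mu> - {x}))) = T"
    using SYT_restrict[of "\<mu> - {x}" x T] T x(2) young_diagram_finite[OF Y]
    unfolding i c[symmetric] by simp_all
  show thesis
    by (rule that[OF SYT_last_corner[OF Y T x] r(1) _ x(2) refl]) (simp only: c r(2))
qed

lemma num_SYT_removal:
  assumes Y: "young_diagram \<mu>" and ne: "\<mu> \<noteq> {}"
  shows "card (SYT \<mu>) = (\<Sum>x\<in>corners \<mu>. card (SYT (\<mu> - {x})))"
proof -
  define E where "E = (\<lambda>(x, T :: nat \<times> nat \<Rightarrow> nat). T(x := card \<mu>))"
  have c: "card \<mu> = Suc (card (\<mu> - {x}))" if "x \<in> corners \<mu>" for x
    using that card_Suc_Diff1[OF young_diagram_finite[OF Y], of x] by (simp add: corners_def)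
  have "SYT \<mu> = E ` (SIGMA x:corners \<mu>. SYT (\<mu> - {x}))"
  proof (intro subset_antisym subsetI)
    fix T assume "T \<in> SYT \<mu>"
    then obtain x T' where "x \<in> corners \<mu>" "T' \<in> SYT (\<mu> - {x})" "T = T'(x := card \<mu>)"
      using SYT_decompose[OF Y ne] by metis
    then show "T \<in> E ` (SIGMA x:corners \<mu>. SYT (\<mu> - {x}))" by (auto simp: E_def)
  next
    fix T assume "T \<in> E ` (SIGMA x:corners \<mu>. SYT (\<mu> - {x}))"
    then obtain x T' where *: "x \<in> corners \<mu>" "T' \<in> SYT (\<mu> - {x})" "T = T'(x := card \<mu>)"
      by (auto simp: E_def)
    have "T'(x := Suc (card (\<mu> - {x}))) \<in> SYT (insert x (\<mu> - {x}))"
      by (rule SYT_extend) (use * addable_Diff_corner[OF Y *(1)] in \<open>auto simp: corners_def\<close>)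
    then show "T \<in> SYT \<mu>"
      by (simp only: *(3) c[OF *(1)] addable_Diff_corner(2)[OF Y *(1)])
  qed
  moreover have "inj_on E (SIGMA x:corners \<mu>. SYT (\<mu> - {x}))"
  proof (rule inj_onI, clarify)
    fix x S y T
    assume h: "x \<in> corners \<mu>" "S \<in> SYT (\<mu> - {x})" "y \<in> corners \<mu>" "T \<in> SYT (\<mu> - {y})"
      and e: "E (x, S) = E (y, T)"
    have e': "S(x := card \<mu>) = T(y := card \<mu>)" using e by (simp add: E_def)
    have xy: "x = y"
    proof (rule ccontr)
      assume "x \<noteq> y"
      then have "S y = card \<mu>" using fun_cong[OF e', of y] by auto
      moreover have "y \<in> \<mu> - {x}" using h \<open>x \<noteq> y\<close> by (auto simp: corners_def)
      ultimately show False using SYT_range[OF h(2), of y] c[OF h(1)] by auto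
    qed
    have "S z = T z" for z
    proof (cases "z = x")
      case True
      then have "S z = undefined" "T z = undefined"
        using SYT_outside[OF h(2), of z] SYT_outside[OF h(4), of z] xy by auto
      then show ?thesis by simp
    qed (use fun_cong[OF e', of z] xy in auto)
    then show "x = y \<and> S = T" using xy by auto
  qed
  ultimately have "card (SYT \<mu>) = card (SIGMA x:corners \<mu>. SYT (\<mu> - {x}))"
    by (simp add: card_image)
  also have "\<dots> = (\<Sum>x\<in>corners \<mu>. card (SYT (\<mu> - {x})))"
    using finite_corners[OF Y] by (subst card_SigmaI) (auto simp: corners_def intro: finite_SYT)
  finally show ?thesis .
qed

text \<open>
  Induction on the shape. Removing the largest entry of the tableaux on the left leads to the
  shapes \<open>\<mu> + x - y\<close>. Those with \<open>x = y\<close> contribute once for each addable box; for the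
  others, the removal can be carried out first, which leads to the induction hypothesis for
  \<open>\<mu> - y\<close> with the term \<open>x = y\<close> missing, once for each corner. There is one more addable
  box than there are corners, which is the increment in the factor.
\<close>

lemma num_SYT_addition:
  assumes "young_diagram \<mu>"
  shows "(\<Sum>x\<in>addable \<mu>. card (SYT (insert x \<mu>))) = Suc (card \<mu>) * card (SYT \<mu>)"
  using assms
proof (induction "card \<mu>" arbitrary: \<mu> rule: less_induct)
  case less
  note Y = less.prems
  let ?f = "\<lambda>\<mu>. int (card (SYT \<mu>))"
  have cor: "y \<in> \<mu>" "young_diagram (\<mu> - {y})" if "y \<in> corners \<mu>" for y
    using that by (auto simp: corners_def)
  have swap: "x \<in> addable \<mu> \<and> y \<in> corners (insert x \<mu>) - {x} \<longleftrightarrow>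
      y \<in> corners \<mu> \<and> x \<in> addable (\<mu> - {y}) - {y}" (is "?L \<longleftrightarrow> ?R") for x y
  proof
    assume ?L
    then have h: "y \<in> \<mu>" "x \<notin> \<mu>" "x \<noteq> y" "young_diagram (insert x \<mu> - {y})"
      by (auto simp: corners_def addable_def)
    have "insert x \<mu> - {y} = insert x (\<mu> - {y})" "\<mu> \<inter> (insert x \<mu> - {y}) = \<mu> - {y}"
      using h by auto
    then show ?R using h young_diagram_Int[OF Y h(4)] by (simp add: corners_def addable_def)
  next
    assume ?R
    then have h: "y \<in> \<mu>" "x \<notin> \<mu>" "x \<noteq> y" "young_diagram (insert x (\<mu> - {y}))"
      by (auto simp: corners_def addable_def)
    have "insert x \<mu> - {y} = insert x (\<mu> - {y})" "\<mu> \<union> insert x (\<mu> - {y}) = insert x \<mu>"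
      using h by auto
    then show ?L using h young_diagram_Un[OF Y h(4)] by (simp add: corners_def addable_def)
  qed
  have "(\<Sum>x\<in>addable \<mu>. ?f (insert x \<mu>)) =
      (\<Sum>x\<in>addable \<mu>. ?f \<mu> + (\<Sum>y\<in>corners (insert x \<mu>) - {x}. ?f (insert x \<mu> - {y})))"
  proof (rule sum.cong[OF refl])
    fix x assume x: "x \<in> addable \<mu>"
    then have Yx: "young_diagram (insert x \<mu>)" and xn: "x \<notin> \<mu>" by (auto simp: addable_def)
    have e: "insert x \<mu> - {x} = \<mu>" using xn by auto
    have xc: "x \<in> corners (insert x \<mu>)" using Y by (simp add: corners_def e)
    have "?f (insert x \<mu>) = (\<Sum>y\<in>corners (insert x \<mu>). ?f (insert x \<mu> - {y}))"
      unfolding num_SYT_removal[OF Yx insert_not_empty] of_nat_sum ..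
    then show "?f (insert x \<mu>) = ?f \<mu> + (\<Sum>y\<in>corners (insert x \<mu>) - {x}. ?f (insert x \<mu> - {y}))"
      unfolding sum.remove[OF finite_corners[OF Yx] xc] e .
  qed
  also have "\<dots> = int (card (addable \<mu>)) * ?f \<mu> +
      (\<Sum>x\<in>addable \<mu>. \<Sum>y\<in>corners (insert x \<mu>) - {x}. ?f (insert x \<mu> - {y}))"
    by (simp add: sum.distrib)
  also have "(\<Sum>x\<in>addable \<mu>. \<Sum>y\<in>corners (insert x \<mu>) - {x}. ?f (insert x \<mu> - {y})) =
      (\<Sum>(x, y)\<in>(SIGMA x:addable \<mu>. corners (insert x \<mu>) - {x}). ?f (insert x \<mu> - {y}))"
    by (rule sum.Sigma) (simp_all add: card_addable[OF Y], auto simp: addable_def intro: finite_corners)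
  also have "\<dots> = (\<Sum>(y, x)\<in>(SIGMA y:corners \<mu>. addable (\<mu> - {y}) - {y}). ?f (insert x (\<mu> - {y})))"
    by (rule sum.reindex_bij_witness[where i = "\<lambda>(y, x). (x, y)" and j = "\<lambda>(x, y). (y, x)"];
        use swap in \<open>fastforce simp: insert_Diff_if\<close>)
  also have "\<dots> = (\<Sum>y\<in>corners \<mu>. \<Sum>x\<in>addable (\<mu> - {y}) - {y}. ?f (insert x (\<mu> - {y})))"
    using finite_corners[OF Y] cor(2) by (subst sum.Sigma) (auto simp: card_addable)
  also have "\<dots> = (\<Sum>y\<in>corners \<mu>. int (card \<mu>) * ?f (\<mu> - {y}) - ?f \<mu>)"
  proof (rule sum.cong[OF refl])
    fix y assume y: "y \<in> corners \<mu>"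
    have c: "card \<mu> = Suc (card (\<mu> - {y}))"
      using card_Suc_Diff1[OF young_diagram_finite[OF Y] cor(1)[OF y]] by simp
    have IH: "(\<Sum>x\<in>addable (\<mu> - {y}). card (SYT (insert x (\<mu> - {y})))) =
        card \<mu> * card (SYT (\<mu> - {y}))"
      using less.hyps[OF card_Diff1_less[OF young_diagram_finite[OF Y] cor(1)[OF y]] cor(2)[OF y]]
      unfolding c[symmetric] .
    have "(\<Sum>x\<in>addable (\<mu> - {y}). ?f (insert x (\<mu> - {y}))) = int (card \<mu>) * ?f (\<mu> - {y})"
      using arg_cong[OF IH, of int] unfolding of_nat_sum of_nat_mult .
    moreover have "(\<Sum>x\<in>addable (\<mu> - {y}). ?f (insert x (\<mu> - {y}))) =
       ?f \<mu> + (\<Sum>x\<in>addable (\<mu> - {y}) - {y}. ?f (insert x (\<mu> - {y})))"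
      using addable_Diff_corner[OF Y y] card_addable(1)[OF cor(2)[OF y]]
      by (subst sum.remove[of _ y]) auto
    ultimately show "(\<Sum>x\<in>addable (\<mu> - {y}) - {y}. ?f (insert x (\<mu> - {y}))) =
       int (card \<mu>) * ?f (\<mu> - {y}) - ?f \<mu>" by simp
  qed
  also have "\<dots> = int (card \<mu>) * (\<Sum>y\<in>corners \<mu>. ?f (\<mu> - {y})) - int (card (corners \<mu>)) * ?f \<mu>"
    by (simp add: sum_subtractf sum_distrib_left)
  also have "int (card \<mu>) * (\<Sum>y\<in>corners \<mu>. ?f (\<mu> - {y})) = int (card \<mu>) * ?f \<mu>"
    using num_SYT_removal[OF Y] by (cases "\<mu> = {}") auto
  finally have "(\<Sum>x\<in>addable \<mu>. ?f (insert x \<mu>)) = int (Suc (card \<mu>) * card (SYT \<mu>))"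
    by (simp add: card_addable[OF Y] algebra_simps)
  then show ?case by (metis of_nat_eq_iff of_nat_sum)
qed

definition young_diagrams :: "nat \<Rightarrow> (nat \<times> nat) set set" where
  "young_diagrams m = {\<mu>. young_diagram \<mu> \<and> card \<mu> = m}"

lemma finite_young_diagrams_of_size: "finite (young_diagrams m)"
  using finite_young_diagrams by (simp add: young_diagrams_def)

text \<open>
  Rewriting one factor \<open>f\<^sup>\<mu>\<close> by removal of a box and then summing over the larger shape
  first gives the factor \<open>m + 1\<close> in the step from \<open>m\<close> to \<open>m + 1\<close>.
\<close>

lemma sum_squares_num_SYT: "(\<Sum>\<mu>\<in>young_diagrams m. (card (SYT \<mu>))\<^sup>2) = fact m"
proof (induction m)
  case 0
  have "young_diagrams 0 = {{}}"
    by (auto simp: young_diagrams_def dest: young_diagram_finite)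
  then show ?case by (simp add: SYT_empty)
next
  case (Suc m)
  have m: "young_diagram \<mu>" "card \<mu> = Suc m" "\<mu> \<noteq> {}" "finite \<mu>" if "\<mu> \<in> young_diagrams (Suc m)" for \<mu>
    using that young_diagram_finite by (auto simp: young_diagrams_def)
  have m': "young_diagram \<mu>" "card \<mu> = m" "finite \<mu>" if "\<mu> \<in> young_diagrams m" for \<mu>
    using that young_diagram_finite by (auto simp: young_diagrams_def)
  have "(\<Sum>\<mu>\<in>young_diagrams (Suc m). (card (SYT \<mu>))\<^sup>2) =
      (\<Sum>\<mu>\<in>young_diagrams (Suc m). \<Sum>x\<in>corners \<mu>. card (SYT (\<mu> - {x})) * card (SYT \<mu>))"
    unfolding power2_eq_square sum_distrib_right[symmetric]
    by (rule sum.cong) (use num_SYT_removal m in auto)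
  also have "\<dots> = (\<Sum>(\<mu>, x)\<in>(SIGMA \<mu>:young_diagrams (Suc m). corners \<mu>). card (SYT (\<mu> - {x})) * card (SYT \<mu>))"
    by (rule sum.Sigma) (auto simp: finite_young_diagrams_of_size dest: m intro: finite_corners)
  also have "\<dots> = (\<Sum>(\<mu>, x)\<in>(SIGMA \<mu>:young_diagrams m. addable \<mu>). card (SYT \<mu>) * card (SYT (insert x \<mu>)))"
    by (rule sum.reindex_bij_witness[where i = "\<lambda>(\<mu>, x). (insert x \<mu>, x)" and j = "\<lambda>(\<mu>, x). (\<mu> - {x}, x)"])
      (auto simp: corners_def addable_def young_diagrams_def insert_absorb young_diagram_finite)
  also have "\<dots> = (\<Sum>\<mu>\<in>young_diagrams m. \<Sum>x\<in>addable \<mu>. card (SYT \<mu>) * card (SYT (insert x \<mu>)))"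
    by (rule sum.Sigma[symmetric]) (auto simp: finite_young_diagrams_of_size dest: m' intro: card_addable)
  also have "\<dots> = (\<Sum>\<mu>\<in>young_diagrams m. Suc m * (card (SYT \<mu>))\<^sup>2)"
    by (rule sum.cong) (simp_all add: sum_distrib_left[symmetric] num_SYT_addition m' power2_eq_square algebra_simps)
  also have "\<dots> = fact (Suc m)" by (simp only: sum_distrib_left[symmetric] Suc fact_Suc of_nat_id)
  finally show ?case .
qed

section \<open>Exchanging entries and contents of tableaux\<close>

text \<open>
  Replacing the values of an injective function by their ranks gives a tableau.
\<close>

lemma SYT_of_key:
  fixes key :: "nat \<times> nat \<Rightarrow> nat"
  assumes fin: "finite \<mu>" and inj: "inj_on key \<mu>"
    and row: "\<And>i j j'. (i, j) \<in> \<mu> \<Longrightarrow> (i, j') \<in> \<mu> \<Longrightarrow> j < j' \<Longrightarrow> key (i, j) < key (i, j')"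
    and col: "\<And>i i' j. (i, j) \<in> \<mu> \<Longrightarrow> (i', j) \<in> \<mu> \<Longrightarrow> i < i' \<Longrightarrow> key (i, j) < key (i', j)"
  obtains T where "T \<in> SYT \<mu>" "\<And>x y. x \<in> \<mu> \<Longrightarrow> y \<in> \<mu> \<Longrightarrow> T x < T y \<longleftrightarrow> key x < key y"
proof -
  define T where "T = restrict (\<lambda>x. card {y \<in> \<mu>. key y \<le> key x}) \<mu>"
  have less: "T x < T y" if "x \<in> \<mu>" "y \<in> \<mu>" "key x < key y" for x y
  proof -
    have "{z \<in> \<mu>. key z \<le> key x} \<subset> {z \<in> \<mu>. key z \<le> key y}" using that by force
    then show ?thesis using that fin by (simp add: T_def psubset_card_mono)
  qed
  have iff: "T x < T y \<longleftrightarrow> key x < key y" if "x \<in> \<mu>" "y \<in> \<mu>" for x y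
    using less[OF that] less[OF that(2,1)] inj_onD[OF inj _ that]
    by (metis less_asym linorder_neqE_nat)
  have "1 \<le> T x \<and> T x \<le> card \<mu>" if "x \<in> \<mu>" for x
  proof -
    have "card {x} \<le> card {y \<in> \<mu>. key y \<le> key x}" using that fin by (intro card_mono) auto
    moreover have "card {y \<in> \<mu>. key y \<le> key x} \<le> card \<mu>" using fin by (intro card_mono) auto
    ultimately show ?thesis using that by (simp add: T_def)
  qed
  then have sub: "T ` \<mu> \<subseteq> {1..card \<mu>}" by auto
  have injT: "inj_on T \<mu>"
  proof (rule inj_onI)
    fix x y assume h: "x \<in> \<mu>" "y \<in> \<mu>" "T x = T y"
    then have "key x = key y" using iff[OF h(1,2)] iff[OF h(2,1)] by simp
    then show "x = y" using inj h by (auto dest: inj_onD)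
  qed
  then have "T ` \<mu> = {1..card \<mu>}"
    using sub by (intro card_subset_eq) (auto simp: card_image)
  then have bij: "bij_betw T \<mu> {1..card \<mu>}" using injT by (simp add: bij_betw_def)
  moreover have "T \<in> \<mu> \<rightarrow>\<^sub>E {1..card \<mu>}" using sub by (auto simp: T_def)
  ultimately have "T \<in> SYT \<mu>"
    unfolding standard_tableaux_def by (auto intro: less row col)
  then show thesis using that iff by blast
qed

lemma lexicographic_encoding:
  fixes a b c d M :: nat
  assumes "b < M" "d < M"
  shows "a * M + b < c * M + d \<longleftrightarrow> a < c \<or> a = c \<and> b < d"
proof -
  have *: "a * M + b < c * M + d" if "a < c" "b < M" for a b c d :: nat
  proof -
    have "a * M + b < Suc a * M" using that by simp
    also have "\<dots> \<le> c * M" using that by (intro mult_le_mono1) simp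
    finally show ?thesis by simp
  qed
  show ?thesis using *[of a c b d] *[of c a d b] assms by (cases a c rule: linorder_cases) auto
qed

text \<open>
  In these two fillings all earlier columns, respectively rows, are complete. This is what the
  Garnir relations need.
\<close>

lemma reading_tableaux:
  assumes "young_diagram \<mu>"
  obtains S T where "S \<in> SYT \<mu>"
      "\<And>x y. x \<in> \<mu> \<Longrightarrow> y \<in> \<mu> \<Longrightarrow> S x < S y \<longleftrightarrow> snd x < snd y \<or> snd x = snd y \<and> fst x < fst y"
      and "T \<in> SYT \<mu>"
      "\<And>x y. x \<in> \<mu> \<Longrightarrow> y \<in> \<mu> \<Longrightarrow> T x < T y \<longleftrightarrow> fst x < fst y \<or> fst x = fst y \<and> snd x < snd y"
proof -
  note fin = young_diagram_finite[OF assms]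
  have "finite (fst ` \<mu> \<union> snd ` \<mu>)" using fin by simp
  then obtain M where "\<forall>n\<in>fst ` \<mu> \<union> snd ` \<mu>. n < M" unfolding finite_nat_set_iff_bounded by blast
  then have M: "fst x < M" "snd x < M" if "x \<in> \<mu>" for x using that by auto
  define k1 k2 :: "nat \<times> nat \<Rightarrow> nat"
    where "k1 = (\<lambda>x. snd x * M + fst x)" and "k2 = (\<lambda>x. fst x * M + snd x)"
  have k1: "k1 x < k1 y \<longleftrightarrow> snd x < snd y \<or> snd x = snd y \<and> fst x < fst y"
    if "x \<in> \<mu>" "y \<in> \<mu>" for x y
    unfolding k1_def by (rule lexicographic_encoding) (use M that in auto)
  have k2: "k2 x < k2 y \<longleftrightarrow> fst x < fst y \<or> fst x = fst y \<and> snd x < snd y"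
    if "x \<in> \<mu>" "y \<in> \<mu>" for x y
    unfolding k2_def by (rule lexicographic_encoding) (use M that in auto)
  have "inj_on k1 \<mu>"
  proof (rule inj_onI)
    fix x y assume "x \<in> \<mu>" "y \<in> \<mu>" "k1 x = k1 y"
    then show "x = y" using k1[of x y] k1[of y x] by (auto simp: prod_eq_iff)
  qed
  then obtain S where S: "S \<in> SYT \<mu>" "\<And>x y. x \<in> \<mu> \<Longrightarrow> y \<in> \<mu> \<Longrightarrow> S x < S y \<longleftrightarrow> k1 x < k1 y"
    by (rule SYT_of_key[OF fin]) (auto simp: k1)
  have "inj_on k2 \<mu>"
  proof (rule inj_onI)
    fix x y assume "x \<in> \<mu>" "y \<in> \<mu>" "k2 x = k2 y"
    then show "x = y" using k2[of x y] k2[of y x] by (auto simp: prod_eq_iff)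
  qed
  then obtain T where T: "T \<in> SYT \<mu>" "\<And>x y. x \<in> \<mu> \<Longrightarrow> y \<in> \<mu> \<Longrightarrow> T x < T y \<longleftrightarrow> k2 x < k2 y"
    by (rule SYT_of_key[OF fin]) (auto simp: k2)
  show thesis using that[of S T] S T k1 k2 by simp
qed

definition swap_entries :: "(nat \<times> nat) set \<Rightarrow> nat \<Rightarrow> (nat \<times> nat \<Rightarrow> nat) \<Rightarrow> nat \<times> nat \<Rightarrow> nat" where
  "swap_entries \<mu> i T = restrict (transpose i (Suc i) \<circ> T) \<mu>"

text \<open>
  If both a tableau and its swap are standard, neither of the two boxes is weakly below and to
  the right of the other one. One of them is then strictly higher and strictly further to the
  right, which moves the content by at least two.
\<close>

lemma swap_entries_content:
  assumes Y: "young_diagram \<mu>" and T: "T \<in> SYT \<mu>" and T': "swap_entries \<mu> i T \<in> SYT \<mu>"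
    and xy: "x \<in> \<mu>" "y \<in> \<mu>" "T x = i" "T y = Suc i"
  shows "\<bar>box_content y - box_content x\<bar> \<ge> 2"
proof -
  obtain r c r' c' where [simp]: "x = (r, c)" "y = (r', c')" by fastforce
  have "\<not> (r' \<le> r \<and> c' \<le> c)" using SYT_mono[OF Y T, of r' c' r c] xy by auto
  moreover have "\<not> (r \<le> r' \<and> c \<le> c')"
    using SYT_mono[OF Y T', of r c r' c'] xy by (auto simp: swap_entries_def)
  ultimately show ?thesis by (auto simp: box_content_def)
qed

text \<open>
  Two tableaux with their largest entry in the same corner are connected by induction. For
  different corners, some tableau has its two largest entries in these corners, and exchanging
  the two leads from the first corner to the second.
\<close>

lemma SYT_connected:
  assumes "young_diagram \<mu>" "S \<in> SYT \<mu>" "T \<in> SYT \<mu>" "Q S"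
    and "\<And>T i. T \<in> SYT \<mu> \<Longrightarrow> 1 \<le> i \<Longrightarrow> i < card \<mu> \<Longrightarrow> swap_entries \<mu> i T \<in> SYT \<mu> \<Longrightarrow> Q T \<Longrightarrow>
      Q (swap_entries \<mu> i T)"
  shows "Q T"
  using assms
proof (induction "card \<mu>" arbitrary: \<mu> Q S T rule: less_induct)
  case less
  note Y = less.prems(1) and step = less.prems(5)
  note fin = young_diagram_finite[OF Y]
  show ?case
  proof (cases "\<mu> = {}")
    case True
    then show ?thesis using less.prems by (auto simp: SYT_empty)
  next
    case False
    have size: "card \<mu> = Suc (card (\<mu> - {x}))" if "x \<in> \<mu>" for x
      using card_Suc_Diff1[OF fin that] by simp
    have corner: "x \<in> \<mu>" "young_diagram (\<mu> - {x})" if "x \<in> corners \<mu>" for x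
      using that by (auto simp: corners_def)
    have extend: "U(x := card \<mu>) \<in> SYT \<mu>" if "x \<in> corners \<mu>" "U \<in> SYT (\<mu> - {x})" for x U
      using SYT_extend[OF corner(2)[OF that(1)] addable_Diff_corner(1)[OF Y that(1)] that(2)]
      unfolding addable_Diff_corner(2)[OF Y that(1)] size[OF corner(1)[OF that(1)]] .
    have same: "Q (U'(x := card \<mu>))"
      if x: "x \<in> corners \<mu>" and U: "U \<in> SYT (\<mu> - {x})" "U' \<in> SYT (\<mu> - {x})" "Q (U(x := card \<mu>))"
      for x U U'
    proof (rule less.hyps[of "\<mu> - {x}" U U' "\<lambda>U. Q (U(x := card \<mu>))"])
      show "card (\<mu> - {x}) < card \<mu>" using size[OF corner(1)[OF x]] by linarith
      fix V i
      assume V: "V \<in> SYT (\<mu> - {x})" "1 \<le> i" "i < card (\<mu> - {x})"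
        "swap_entries (\<mu> - {x}) i V \<in> SYT (\<mu> - {x})" "Q (V(x := card \<mu>))"
      have i: "i < card \<mu>" "Suc i < card \<mu>" using V(3) size[OF corner(1)[OF x]] by linarith+
      have e: "swap_entries \<mu> i (V(x := card \<mu>)) = (swap_entries (\<mu> - {x}) i V)(x := card \<mu>)"
        using i corner(1)[OF x] by (auto simp: swap_entries_def fun_eq_iff)
      show "Q ((swap_entries (\<mu> - {x}) i V)(x := card \<mu>))"
        using step[of "V(x := card \<mu>)" i] extend[OF x V(1)] extend[OF x V(4)] V(2,5) i
        unfolding e by blast
    qed (use that corner(2)[OF x] in auto)
    obtain x S' where x: "x \<in> corners \<mu>" and S': "S' \<in> SYT (\<mu> - {x})" "S = S'(x := card \<mu>)"
      using SYT_decompose[OF Y False less.prems(2)] by metis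
    obtain y T' where y: "y \<in> corners \<mu>" and T': "T' \<in> SYT (\<mu> - {y})" "T = T'(y := card \<mu>)"
      using SYT_decompose[OF Y False less.prems(3)] by metis
    show ?thesis
    proof (cases "x = y")
      case True
      then show ?thesis using same[OF x S'(1) _ less.prems(4)[unfolded S'(2)]] T' by simp
    next
      case False
      let ?K = "\<mu> - {x} - {y}"
      have yx: "y \<in> \<mu> - {x}" "x \<in> \<mu> - {y}" using False corner(1) x y by auto
      have K: "young_diagram ?K"
      proof -
        have "?K = (\<mu> - {x}) \<inter> (\<mu> - {y})" by auto
        then show ?thesis using young_diagram_Int[OF corner(2)[OF x] corner(2)[OF y]] by (simp only:)
      qed
      obtain U where U: "U \<in> SYT ?K" using reading_tableaux[OF K] by metis
      have K': "insert y ?K = \<mu> - {x}" "insert x ?K = \<mu> - {y}" using yx by auto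
      have ad: "y \<in> addable ?K" "x \<in> addable ?K"
        unfolding addable_def mem_Collect_eq K' using corner(2) x y by auto
      define m where "m = Suc (card ?K)"
      have "finite (\<mu> - {x})" using fin by simp
      then have cK: "card \<mu> = Suc m"
        using size[OF corner(1)[OF x]] card_Suc_Diff1[OF _ yx(1)] unfolding m_def by linarith
      have U1: "U(y := m) \<in> SYT (\<mu> - {x})" and U2: "U(x := m) \<in> SYT (\<mu> - {y})"
        using SYT_extend[OF K ad(1) U] SYT_extend[OF K ad(2) U] unfolding K' m_def by auto
      have Um: "U z < m" if "z \<in> ?K" for z using SYT_range[OF U that] by (simp add: m_def)
      have e: "swap_entries \<mu> m (U(y := m, x := card \<mu>)) = U(x := m, y := card \<mu>)"
      proof
        fix z
        consider "z = x" | "z = y" | "z \<notin> \<mu>" | "z \<in> ?K" by blast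
        then show "swap_entries \<mu> m (U(y := m, x := card \<mu>)) z = (U(x := m, y := card \<mu>)) z"
        proof cases
          case 3
          then show ?thesis using SYT_outside[OF U, of z] yx by (auto simp: swap_entries_def)
        next
          case 4
          then show ?thesis using Um[OF 4] by (auto simp: swap_entries_def transpose_def)
        qed (use yx False in \<open>auto simp: swap_entries_def cK\<close>)
      qed
      have "Q (U(y := m, x := card \<mu>))"
        by (rule same[OF x S'(1) U1]) (use less.prems(4) S'(2) in simp)
      then have "Q (U(x := m, y := card \<mu>))"
        using step[OF extend[OF x U1], of m] extend[OF y U2] cK unfolding e by (simp add: m_def)
      then show ?thesis using same[OF y U2 T'(1)] T'(2) by simp
    qed
  qed
qed

text \<open>
  Removing the largest entries, the shapes that remain agree by induction, and the last boxes
  are addable boxes of the same shape with the same content.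
\<close>

lemma SYT_determined_by_contents:
  assumes "young_diagram \<mu>" "young_diagram \<nu>" "card \<mu> = card \<nu>" "S \<in> SYT \<mu>" "T \<in> SYT \<nu>"
    and "\<And>x y. x \<in> \<mu> \<Longrightarrow> y \<in> \<nu> \<Longrightarrow> S x = T y \<Longrightarrow> box_content x = box_content y"
  shows "\<mu> = \<nu> \<and> S = T"
  using assms
proof (induction "card \<mu>" arbitrary: \<mu> \<nu> S T rule: less_induct)
  case less
  note Y = less.prems(1,2) and c = less.prems(3)
  note fin = young_diagram_finite[OF Y(1)] young_diagram_finite[OF Y(2)]
  show ?case
  proof (cases "\<mu> = {}")
    case True
    then have "\<nu> = {}" using c fin by simp
    then show ?thesis using True less.prems by (simp add: SYT_empty)
  next
    case False
    then have "\<nu> \<noteq> {}" using c fin by auto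
    obtain x S' where x: "x \<in> corners \<mu>" and S': "S' \<in> SYT (\<mu> - {x})" "S = S'(x := card \<mu>)" "S x = card \<mu>"
      using SYT_decompose[OF Y(1) False less.prems(4)] by metis
    obtain y T' where y: "y \<in> corners \<nu>" and T': "T' \<in> SYT (\<nu> - {y})" "T = T'(y := card \<nu>)" "T y = card \<nu>"
      using SYT_decompose[OF Y(2) \<open>\<nu> \<noteq> {}\<close> less.prems(5)] by metis
    have xm: "x \<in> \<mu>" "young_diagram (\<mu> - {x})" "y \<in> \<nu>" "young_diagram (\<nu> - {y})"
      using x y by (auto simp: corners_def)
    have "\<mu> - {x} = \<nu> - {y} \<and> S' = T'"
    proof (rule less.hyps[OF card_Diff1_less[OF fin(1) xm(1)] xm(2,4) _ S'(1) T'(1)])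
      show "card (\<mu> - {x}) = card (\<nu> - {y})" using c fin xm by simp
      fix a b assume "a \<in> \<mu> - {x}" "b \<in> \<nu> - {y}" "S' a = T' b"
      then show "box_content a = box_content b" using less.prems(6)[of a b] S'(2) T'(2) by auto
    qed
    moreover have "box_content x = box_content y" using less.prems(6)[OF xm(1,3)] S'(3) T'(3) c by simp
    ultimately have "x = y"
      using addable_content_inj[of x "\<mu> - {x}" y] addable_Diff_corner(1)[OF Y(1) x]
        addable_Diff_corner(1)[OF Y(2) y] by simp
    then show ?thesis
      using \<open>\<mu> - {x} = \<nu> - {y} \<and> S' = T'\<close> S'(2) T'(2) c xm by (metis insert_Diff)
  qed
qed

section \<open>Jucys--Murphy elements and intertwiners\<close>

abbreviation pinv :: "(nat \<Rightarrow> nat) \<Rightarrow> nat \<Rightarrow> nat" where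
  "pinv \<equiv> inv_into UNIV"

text \<open>
  A function \<open>v\<close> on permutations stands for the element \<open>\<Sum>p. v p \<cdot> p\<close> of the group
  algebra. As transpositions are involutions, \<open>p \<mapsto> v ((j l) \<circ> p)\<close> is its product with
  \<open>(j l)\<close> from the left. Right multiplication corresponds to left multiplication of
  \<open>p \<mapsto> v (p\<inverse>)\<close>, so the operator for the left side serves both sides.
\<close>

definition jucys_murphy :: "nat \<Rightarrow> ((nat \<Rightarrow> nat) \<Rightarrow> rat) \<Rightarrow> (nat \<Rightarrow> nat) \<Rightarrow> rat" where
  "jucys_murphy l v p = (\<Sum>j\<in>{1..<l}. v (transpose j l \<circ> p))"

definition has_weight ::
    "(nat \<times> nat) set \<Rightarrow> (nat \<times> nat \<Rightarrow> nat) \<Rightarrow> ((nat \<Rightarrow> nat) \<Rightarrow> rat) \<Rightarrow> bool" where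
  "has_weight \<mu> T v \<longleftrightarrow> (\<forall>x\<in>\<mu>. \<forall>p. p permutes {1..card \<mu>} \<longrightarrow>
     jucys_murphy (T x) v p = of_int (box_content x) * v p)"

lemma conjugate_transpose: "inj s \<Longrightarrow> s \<circ> transpose a b = transpose (s a) (s b) \<circ> s"
  by (auto simp: fun_eq_iff transpose_def inj_eq)

lemma permutes_transpose_comp:
  assumes "p permutes A" "a \<in> A" "b \<in> A"
  shows "transpose a b \<circ> p permutes A"
  using assms by (intro permutes_compose[OF _ permutes_swap_id])

text \<open>
  The relation \<open>J\<^sub>i s\<^sub>i = s\<^sub>i J\<^sub>i\<^sub>+\<^sub>1 - 1\<close> shows that \<open>J\<^sub>i\<close> and \<open>J\<^sub>i\<^sub>+\<^sub>1\<close> act on the span of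
  \<open>v\<close> and \<open>s\<^sub>i v\<close> by triangular matrices. The corrected vector is the eigenvector with the
  two eigenvalues exchanged; all other \<open>J\<^sub>l\<close> commute with \<open>s\<^sub>i\<close>.
\<close>

lemma has_weight_swap:
  assumes Y: "young_diagram \<mu>" and T: "T \<in> SYT \<mu>" and T': "swap_entries \<mu> i T \<in> SYT \<mu>"
    and xy: "x \<in> \<mu>" "y \<in> \<mu>" "T x = i" "T y = Suc i"
    and v: "has_weight \<mu> T v"
  shows "has_weight \<mu> (swap_entries \<mu> i T)
    (\<lambda>p. v (transpose i (Suc i) \<circ> p) - v p / of_int (box_content y - box_content x))"
    (is "has_weight \<mu> ?T ?v")
  unfolding has_weight_def
proof (intro ballI allI impI)
  fix z p assume z: "z \<in> \<mu>" and p: "p permutes {1..card \<mu>}"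
  let ?s = "transpose i (Suc i)"
  define a b where "a = (of_int (box_content x) :: rat)" and "b = (of_int (box_content y) :: rat)"
  have "box_content y - box_content x \<noteq> 0" using swap_entries_content[OF Y T T' xy] by auto
  then have d: "b - a \<noteq> 0" unfolding a_def b_def by (metis of_int_diff of_int_eq_0_iff)
  have i: "1 \<le> i" "Suc i \<le> card \<mu>" using SYT_range[OF T xy(1)] SYT_range[OF T xy(2)] xy by simp_all
  have sp: "?s \<circ> p permutes {1..card \<mu>}" using p i by (intro permutes_transpose_comp) auto
  have w: "jucys_murphy (T u) v q = of_int (box_content u) * v q"
    if "u \<in> \<mu>" "q permutes {1..card \<mu>}" for u q
    using v that unfolding has_weight_def by blast
  have split: "jucys_murphy l ?v p = jucys_murphy l (\<lambda>q. v (?s \<circ> q)) p - jucys_murphy l v p / (b - a)" for l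
    by (simp add: jucys_murphy_def sum_subtractf sum_divide_distrib a_def b_def)
  have conj: "?s \<circ> (transpose j l \<circ> p) = transpose (?s j) (?s l) \<circ> (?s \<circ> p)" for j l
    using conjugate_transpose[of ?s j l] by (simp flip: comp_assoc)
  have below: "?s j = j" if "j \<in> {1..<i}" for j using that by (auto simp: transpose_def)
  have ss: "?s \<circ> (?s \<circ> p) = p" by (simp flip: comp_assoc)
  have Suc_i: "{1..<Suc i} = insert i {1..<i}" using i by auto
  consider "z = x" | "z = y" | "T z \<noteq> i" "T z \<noteq> Suc i"
    using SYT_inj[OF T z xy(1)] SYT_inj[OF T z xy(2)] xy(3,4) by metis
  then show "jucys_murphy (?T z) ?v p = of_int (box_content z) * ?v p"
  proof cases
    case 1
    have "jucys_murphy (Suc i) (\<lambda>q. v (?s \<circ> q)) p =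
        v p + (\<Sum>j\<in>{1..<i}. v (transpose j i \<circ> (?s \<circ> p)))"
      unfolding jucys_murphy_def Suc_i conj by (simp add: below ss comp_assoc transpose_commute)
    also have "\<dots> = v p + a * v (?s \<circ> p)"
      using w[OF xy(1) sp] xy(3) by (simp add: jucys_murphy_def a_def)
    finally have "jucys_murphy (Suc i) ?v p = v p + a * v (?s \<circ> p) - b * v p / (b - a)"
      unfolding split using w[OF xy(2) p] xy(4) by (simp add: b_def)
    also have "\<dots> = a * (v (?s \<circ> p) - v p / (b - a))" using d by (simp add: field_simps)
    finally show ?thesis using 1 xy by (simp add: swap_entries_def a_def b_def)
  next
    case zy: 2
    have 1: "jucys_murphy (Suc i) v (?s \<circ> p) = v p + (\<Sum>j\<in>{1..<i}. v (transpose j (Suc i) \<circ> (?s \<circ> p)))"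
      unfolding jucys_murphy_def Suc_i by (simp add: ss)
    have 2: "(\<Sum>j\<in>{1..<i}. v (transpose j (Suc i) \<circ> (?s \<circ> p))) = jucys_murphy i (\<lambda>q. v (?s \<circ> q)) p"
      unfolding jucys_murphy_def conj by (simp add: below)
    have "jucys_murphy i (\<lambda>q. v (?s \<circ> q)) p = b * v (?s \<circ> p) - v p"
      using 1 w[OF xy(2) sp] unfolding 2 xy(4) b_def by linarith
    then have "jucys_murphy i ?v p = b * v (?s \<circ> p) - v p - a * v p / (b - a)"
      unfolding split using w[OF xy(1) p] xy(3) by (simp add: a_def)
    also have "\<dots> = b * (v (?s \<circ> p) - v p / (b - a))" using d by (simp add: field_simps)
    finally show ?thesis using zy xy by (simp add: swap_entries_def a_def b_def)
  next
    case 3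
    then have f: "?s (T z) = T z" by simp
    have range: "?s j \<in> {1..<T z} \<longleftrightarrow> j \<in> {1..<T z}" for j
      using 3 i by (auto simp: transpose_def)
    have "jucys_murphy (T z) (\<lambda>q. v (?s \<circ> q)) p = (\<Sum>j\<in>{1..<T z}. v (transpose (?s j) (T z) \<circ> (?s \<circ> p)))"
      unfolding jucys_murphy_def conj f ..
    also have "\<dots> = jucys_murphy (T z) v (?s \<circ> p)"
      unfolding jucys_murphy_def
      by (rule sum.reindex_bij_witness[where i = ?s and j = ?s]) (simp_all only: range transpose_involutory)
    finally have "jucys_murphy (T z) ?v p = of_int (box_content z) * v (?s \<circ> p) - of_int (box_content z) * v p / (b - a)"
      unfolding split w[OF z sp] w[OF z p] by simp
    moreover have "?T z = T z" using z f by (simp add: swap_entries_def)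
    ultimately show ?thesis
      by (simp only: right_diff_distrib times_divide_eq_right a_def b_def of_int_diff)
  qed
qed

definition bi_weight_vector ::
    "(nat \<times> nat) set \<Rightarrow> (nat \<times> nat \<Rightarrow> nat) \<Rightarrow> (nat \<times> nat \<Rightarrow> nat) \<Rightarrow> ((nat \<Rightarrow> nat) \<Rightarrow> rat) \<Rightarrow> bool" where
  "bi_weight_vector \<mu> S T v \<longleftrightarrow> has_weight \<mu> S v \<and> has_weight \<mu> T (\<lambda>p. v (pinv p)) \<and>
     (\<exists>p. p permutes {1..card \<mu>} \<and> v p \<noteq> 0)"

lemma inv_transpose_comp: "p permutes A \<Longrightarrow> pinv (transpose a b \<circ> p) = pinv p \<circ> transpose a b"
  by (simp add: o_inv_distrib permutes_bij)

lemma has_weight_cong: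
  assumes T: "T \<in> SYT \<mu>" and v: "has_weight \<mu> T v" and eq: "\<And>p. p permutes {1..card \<mu>} \<Longrightarrow> v p = w p"
  shows "has_weight \<mu> T w"
  unfolding has_weight_def
proof (intro ballI allI impI)
  fix x p assume h: "x \<in> \<mu>" "p permutes {1..card \<mu>}"
  have "jucys_murphy (T x) w p = jucys_murphy (T x) v p"
    unfolding jucys_murphy_def using SYT_range[OF T h(1)] h(2)
    by (intro sum.cong refl eq[symmetric] permutes_transpose_comp) auto
  then show "jucys_murphy (T x) w p = of_int (box_content x) * w p"
    using v h eq unfolding has_weight_def by simp
qed

lemma bi_weight_vector_commute:
  assumes "S \<in> SYT \<mu>" "bi_weight_vector \<mu> S T v"
  shows "bi_weight_vector \<mu> T S (\<lambda>p. v (pinv p))"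
proof -
  have ii: "v p = v (pinv (pinv p))" if "p permutes {1..card \<mu>}" for p
    using that by (simp add: permutes_inv_inv)
  have S: "has_weight \<mu> S v" using assms(2) by (simp add: bi_weight_vector_def)
  obtain p where "p permutes {1..card \<mu>}" "v p \<noteq> 0"
    using assms(2) by (auto simp: bi_weight_vector_def)
  then have "pinv p permutes {1..card \<mu>}" "v (pinv (pinv p)) \<noteq> 0"
    by (simp_all add: permutes_inv permutes_inv_inv)
  then show ?thesis
    using assms(2) has_weight_cong[OF assms(1) S ii] unfolding bi_weight_vector_def by blast
qed

text \<open>
  If \<open>s\<^sub>i v = v / d\<close> then \<open>v = v / d\<^sup>2\<close>, which is impossible for \<open>v \<noteq> 0\<close> since
  \<open>\<bar>d\<bar> \<ge> 2\<close>: the intertwiner does not annihilate \<open>v\<close>.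
\<close>

lemma bi_weight_vector_swap:
  assumes Y: "young_diagram \<mu>" and S: "S \<in> SYT \<mu>" and S': "swap_entries \<mu> i S \<in> SYT \<mu>"
    and T: "T \<in> SYT \<mu>" and i: "1 \<le> i" "i < card \<mu>" and v: "bi_weight_vector \<mu> S T v"
  shows "\<exists>w. bi_weight_vector \<mu> (swap_entries \<mu> i S) T w"
proof -
  let ?s = "transpose i (Suc i)"
  obtain x where x: "x \<in> \<mu>" "S x = i" using SYT_surj[OF S, of i] i by auto
  obtain y where y: "y \<in> \<mu>" "S y = Suc i" using SYT_surj[OF S, of "Suc i"] i by auto
  define d :: rat where "d = of_int (box_content y - box_content x)"
  have "\<bar>box_content y - box_content x\<bar> \<ge> 2" using swap_entries_content[OF Y S S' x(1) y(1) x(2) y(2)] .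
  then have d: "\<bar>d\<bar> \<ge> 2" unfolding d_def by (metis of_int_abs of_int_le_iff of_int_numeral)
  define w where "w = (\<lambda>p. v (?s \<circ> p) - v p / d)"
  have "has_weight \<mu> (swap_entries \<mu> i S) w"
    unfolding w_def d_def
    by (rule has_weight_swap[OF Y S S' x(1) y(1) x(2) y(2)]) (use v in \<open>simp add: bi_weight_vector_def\<close>)
  moreover have "has_weight \<mu> T (\<lambda>p. w (pinv p))"
    unfolding has_weight_def
  proof (intro ballI allI impI)
    fix z p assume z: "z \<in> \<mu>" and p: "p permutes {1..card \<mu>}"
    have s: "?s permutes {1..card \<mu>}" using i by (intro permutes_swap_id) auto
    have sp: "p \<circ> ?s permutes {1..card \<mu>}" by (rule permutes_compose[OF s p])
    have inv_ps: "pinv (p \<circ> ?s) = ?s \<circ> pinv p"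
      by (simp add: o_inv_distrib permutes_bij[OF p])
    have vT: "jucys_murphy (T z) (\<lambda>p. v (pinv p)) q = of_int (box_content z) * v (pinv q)"
      if "q permutes {1..card \<mu>}" for q
      using v z that unfolding bi_weight_vector_def has_weight_def by blast
    have inv_tps: "pinv (transpose j (T z) \<circ> (p \<circ> ?s)) = ?s \<circ> (pinv p \<circ> transpose j (T z))" for j
      by (simp add: inv_transpose_comp[OF sp] inv_ps comp_assoc)
    have "jucys_murphy (T z) (\<lambda>p. w (pinv p)) p =
        jucys_murphy (T z) (\<lambda>p. v (pinv p)) (p \<circ> ?s) - jucys_murphy (T z) (\<lambda>p. v (pinv p)) p / d"
      unfolding jucys_murphy_def inv_tps
      by (simp add: w_def inv_transpose_comp[OF p] sum_subtractf sum_divide_distrib comp_assoc)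
    also have "\<dots> = of_int (box_content z) * w (pinv p)"
      unfolding vT[OF sp] vT[OF p] inv_ps by (simp add: w_def algebra_simps)
    finally show "jucys_murphy (T z) (\<lambda>p. w (pinv p)) p = of_int (box_content z) * w (pinv p)" .
  qed
  moreover have "\<exists>p. p permutes {1..card \<mu>} \<and> w p \<noteq> 0"
  proof (rule ccontr)
    assume "\<not> ?thesis"
    then have z: "v (?s \<circ> p) = v p / d" if "p permutes {1..card \<mu>}" for p
      using that by (auto simp: w_def)
    have "v p = 0" if p: "p permutes {1..card \<mu>}" for p
    proof -
      have sp: "?s \<circ> p permutes {1..card \<mu>}" using p i by (intro permutes_transpose_comp) auto
      have "?s \<circ> (?s \<circ> p) = p" by (simp flip: comp_assoc)
      then have "v p = v p / d / d" using z[OF sp] z[OF p] by simp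
      then have "v p * (d * d - 1) = 0" using d by (simp add: field_simps split: if_splits)
      moreover have "d * d \<ge> 2 * 2" using mult_mono[OF d d] by (simp add: abs_mult_self_eq)
      ultimately show ?thesis by auto
    qed
    then show False using v by (auto simp: bi_weight_vector_def)
  qed
  ultimately show ?thesis unfolding bi_weight_vector_def by blast
qed

lemma bi_weight_vector_exists_all:
  assumes Y: "young_diagram \<mu>" and "S \<in> SYT \<mu>" "T \<in> SYT \<mu>" "S' \<in> SYT \<mu>" "T' \<in> SYT \<mu>"
    and "\<exists>v. bi_weight_vector \<mu> S T v"
  shows "\<exists>v. bi_weight_vector \<mu> S' T' v"
proof -
  have left: "\<exists>v. bi_weight_vector \<mu> B C v"
    if AB: "A \<in> SYT \<mu>" "B \<in> SYT \<mu>" and C: "C \<in> SYT \<mu>" and v: "\<exists>v. bi_weight_vector \<mu> A C v" for A B C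
  proof (rule SYT_connected[OF Y AB])
    show "\<exists>v. bi_weight_vector \<mu> A C v" by (rule v)
  qed (use C in \<open>auto intro: bi_weight_vector_swap[OF Y]\<close>)
  have "\<exists>v. bi_weight_vector \<mu> S' T v" by (rule left[of S]) (use assms in auto)
  then have "\<exists>v. bi_weight_vector \<mu> T S' v" using bi_weight_vector_commute[OF assms(4)] by blast
  then have "\<exists>v. bi_weight_vector \<mu> T' S' v" using left[of T T' S'] assms by blast
  then show ?thesis using bi_weight_vector_commute[OF assms(5)] by blast
qed

section \<open>Garnir relations and a first common eigenvector\<close>

text \<open>
  For \<open>\<epsilon> = 1\<close> think of \<open>C\<close> as a column of a tableau and of \<open>i\<close> as an entry further to
  the right. The difference \<open>U\<close> of the two sides is \<open>v\<close> antisymmetrized over \<open>C \<union> {i}\<close>,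
  up to a factor. If the key agrees at two of these elements, exchanging them fixes the
  values of \<open>v\<close> in question and hence \<open>U\<close>, so that \<open>U\<close> vanishes by antisymmetry. If it never agrees, then all values of
  \<open>v\<close> that enter \<open>U\<close> vanish by the assumption on the support. For \<open>\<epsilon> = -1\<close> rows and
  columns, and symmetry and antisymmetry, are interchanged.
\<close>

lemma garnir_relation:
  fixes v :: "(nat \<Rightarrow> nat) \<Rightarrow> rat" and \<epsilon> :: rat and key :: "nat \<Rightarrow> 'k"
  assumes C: "C \<subseteq> A" "finite C" and i: "i \<in> A" "i \<notin> C" and eps: "\<epsilon> * \<epsilon> = 1"
    and anti: "\<And>a b p. p permutes A \<Longrightarrow> a \<in> C \<Longrightarrow> b \<in> C \<Longrightarrow> a \<noteq> b \<Longrightarrow> v (transpose a b \<circ> p) = - \<epsilon> * v p"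
    and sym: "\<And>x y p. p permutes A \<Longrightarrow> x \<in> insert i C \<Longrightarrow> y \<in> insert i C \<Longrightarrow> x \<noteq> y \<Longrightarrow>
      key (pinv p x) = key (pinv p y) \<Longrightarrow> v (transpose x y \<circ> p) = \<epsilon> * v p"
    and supp: "\<And>p. p permutes A \<Longrightarrow> v p \<noteq> 0 \<Longrightarrow> \<exists>x\<in>C. key (pinv p x) = key (pinv p i)"
    and p: "p permutes A"
  shows "(\<Sum>a\<in>C. v (transpose a i \<circ> p)) = \<epsilon> * v p"
proof -
  define U where "U p = v p - \<epsilon> * (\<Sum>a\<in>C. v (transpose a i \<circ> p))" for p
  have perm: "transpose a b \<circ> q permutes A" if "q permutes A" "a \<in> insert i C" "b \<in> insert i C" for a b q
    using that C(1) i by (intro permutes_transpose_comp) auto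
  have ee: "\<epsilon> * (\<epsilon> * z) = z" for z using eps by (metis mult.assoc mult_1)
  have anti_C: "U (transpose x y \<circ> q) = - \<epsilon> * U q"
    if q: "q permutes A" and xy: "x \<in> C" "y \<in> C" "x \<noteq> y" for x y q
  proof -
    have m: "transpose x y a \<in> C \<longleftrightarrow> a \<in> C" for a using xy by (auto simp: transpose_def)
    have fix_i: "transpose x y i = i" using xy i by (auto simp: transpose_def)
    have "v (transpose a i \<circ> (transpose x y \<circ> q)) = - \<epsilon> * v (transpose (transpose x y a) i \<circ> q)"
      if a: "a \<in> C" for a
    proof -
      have "transpose a i \<circ> (transpose x y \<circ> q) = transpose x y \<circ> (transpose (transpose x y a) i \<circ> q)"
        using conjugate_transpose[of "transpose x y" "transpose x y a" i]
        by (simp add: fix_i flip: comp_assoc)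
      moreover have "transpose (transpose x y a) i \<circ> q permutes A"
        using q m a by (intro perm) auto
      ultimately show ?thesis using anti[OF _ xy] by simp
    qed
    then have 1: "(\<Sum>a\<in>C. v (transpose a i \<circ> (transpose x y \<circ> q))) =
        - \<epsilon> * (\<Sum>a\<in>C. v (transpose (transpose x y a) i \<circ> q))"
      by (simp add: sum_distrib_left)
    have 2: "(\<Sum>a\<in>C. v (transpose (transpose x y a) i \<circ> q)) = (\<Sum>a\<in>C. v (transpose a i \<circ> q))"
      by (rule sum.reindex_bij_witness[where i = "transpose x y" and j = "transpose x y"])
        (simp_all only: m transpose_involutory)
    show ?thesis unfolding U_def 1 2 anti[OF q xy] by (simp add: algebra_simps)
  qed
  have anti_i: "U (transpose x i \<circ> q) = - \<epsilon> * U q" if q: "q permutes A" and x: "x \<in> C" for x q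
  proof -
    have xi: "x \<noteq> i" using x i by auto
    have "v (transpose a i \<circ> (transpose x i \<circ> q)) = - \<epsilon> * v (transpose a i \<circ> q)" if a: "a \<in> C - {x}" for a
    proof -
      have "transpose a i \<circ> transpose x i = transpose a x \<circ> transpose a i"
        using a xi i by (auto simp: fun_eq_iff transpose_def)
      then have "v (transpose a i \<circ> (transpose x i \<circ> q)) = v (transpose a x \<circ> (transpose a i \<circ> q))"
        by (simp flip: comp_assoc)
      also have "\<dots> = - \<epsilon> * v (transpose a i \<circ> q)"
        by (rule anti) (use a x q in \<open>auto intro!: perm\<close>)
      finally show ?thesis .
    qed
    moreover have "transpose x i \<circ> (transpose x i \<circ> q) = q" by (simp flip: comp_assoc)
    ultimately have 1: "(\<Sum>a\<in>C. v (transpose a i \<circ> (transpose x i \<circ> q))) =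
        v q - \<epsilon> * (\<Sum>a\<in>C - {x}. v (transpose a i \<circ> q))"
      using C x by (subst sum.remove[of _ x]) (simp_all add: sum_distrib_left sum_negf)
    have 2: "(\<Sum>a\<in>C. v (transpose a i \<circ> q)) =
        v (transpose x i \<circ> q) + (\<Sum>a\<in>C - {x}. v (transpose a i \<circ> q))"
      using C x by (subst sum.remove[of _ x]) simp_all
    show ?thesis unfolding U_def 1 2 by (simp add: algebra_simps ee)
  qed
  have anti_U: "U (transpose x y \<circ> q) = - \<epsilon> * U q"
    if "q permutes A" "x \<in> insert i C" "y \<in> insert i C" "x \<noteq> y" for x y q
    using that anti_C[of q x y] anti_i[of q x] anti_i[of q y] by (auto simp: transpose_commute)
  have "U p = 0"
  proof (cases "\<exists>x\<in>insert i C. \<exists>y\<in>insert i C. x \<noteq> y \<and> key (pinv p x) = key (pinv p y)")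
    case True
    then obtain x y where xy: "x \<in> insert i C" "y \<in> insert i C" "x \<noteq> y" "key (pinv p x) = key (pinv p y)"
      by blast
    have "v (transpose a i \<circ> (transpose x y \<circ> p)) = \<epsilon> * v (transpose a i \<circ> p)" if a: "a \<in> C" for a
    proof -
      let ?t = "transpose a i"
      have m: "?t z \<in> insert i C" if "z \<in> insert i C" for z using that a by (auto simp: transpose_def)
      have k: "pinv (?t \<circ> p) (?t z) = pinv p z" for z by (simp add: inv_transpose_comp[OF p])
      have "v (?t \<circ> (transpose x y \<circ> p)) = v (transpose (?t x) (?t y) \<circ> (?t \<circ> p))"
        using conjugate_transpose[of ?t x y] by (simp flip: comp_assoc)
      also have "\<dots> = \<epsilon> * v (?t \<circ> p)"
      proof (rule sym)
        show "?t \<circ> p permutes A" using p a by (intro perm) auto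
        show "?t x \<noteq> ?t y" using xy(3) by (metis transpose_involutory)
        show "key (pinv (?t \<circ> p) (?t x)) = key (pinv (?t \<circ> p) (?t y))" unfolding k by (rule xy(4))
      qed (use xy m in auto)
      finally show ?thesis .
    qed
    then have "(\<Sum>a\<in>C. v (transpose a i \<circ> (transpose x y \<circ> p))) = \<epsilon> * (\<Sum>a\<in>C. v (transpose a i \<circ> p))"
      by (simp add: sum_distrib_left)
    then have "U (transpose x y \<circ> p) = \<epsilon> * U p"
      unfolding U_def sym[OF p xy] by (simp add: algebra_simps)
    then have "\<epsilon> * U p = 0" using anti_U[OF p xy(1-3)] by simp
    then show ?thesis using eps by auto
  next
    case False
    then have ne: "key (pinv p a) \<noteq> key (pinv p b)" if "a \<in> insert i C" "b \<in> insert i C" "a \<noteq> b" for a b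
      using that by metis
    have "v p = 0"
    proof (rule ccontr)
      assume "v p \<noteq> 0"
      then obtain a where "a \<in> C" "key (pinv p a) = key (pinv p i)" using supp[OF p] by metis
      then show False using ne[of a i] i(2) by auto
    qed
    moreover have "v (transpose a i \<circ> p) = 0" if a: "a \<in> C" for a
    proof (rule ccontr)
      let ?t = "transpose a i"
      assume "v (?t \<circ> p) \<noteq> 0"
      moreover have "?t \<circ> p permutes A" using p a by (intro perm) auto
      ultimately obtain x where x: "x \<in> C" "key (pinv p (?t x)) = key (pinv p (?t i))"
        using supp[of "?t \<circ> p"] by (auto simp: inv_transpose_comp[OF p])
      have "?t x \<in> insert i C" "?t i \<in> insert i C" "?t x \<noteq> ?t i"
        using x(1) a i by (auto simp: transpose_def)
      then show False using ne x(2) by metis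
    qed
    ultimately show ?thesis by (simp add: U_def)
  qed
  then have "v p = \<epsilon> * (\<Sum>a\<in>C. v (transpose a i \<circ> p))" by (simp add: U_def)
  then show ?thesis using ee by simp
qed

text \<open>
  Suppose that a tableau is filled line after line, with \<open>f\<close> the number of the line (column or
  row) of a box and \<open>g\<close> its position in it. Then the entries below \<open>T x\<close> form the \<open>f x - 1\<close>
  earlier lines, which are complete, and the \<open>g x - 1\<close> earlier positions in the line of \<open>x\<close>.
\<close>

lemma reading_order_sum:
  fixes F :: "nat \<Rightarrow> rat" and f g :: "nat \<times> nat \<Rightarrow> nat"
  assumes T: "T \<in> SYT \<mu>" and fin: "finite \<mu>" and x: "x \<in> \<mu>"
    and order: "\<And>y. y \<in> \<mu> \<Longrightarrow> T y < T x \<longleftrightarrow> f y < f x \<or> f y = f x \<and> g y < g x"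
    and pos: "\<And>y. y \<in> \<mu> \<Longrightarrow> 1 \<le> f y" "1 \<le> g x"
    and full: "\<And>c. 1 \<le> c \<Longrightarrow> c < f x \<Longrightarrow> (\<Sum>j\<in>T ` {y \<in> \<mu>. f y = c}. F j) = A"
    and part: "\<And>y. y \<in> \<mu> \<Longrightarrow> f y = f x \<Longrightarrow> g y < g x \<Longrightarrow> F (T y) = - A"
    and card: "card {y \<in> \<mu>. f y = f x \<and> g y < g x} = g x - 1"
  shows "(\<Sum>j\<in>{1..<T x}. F j) = (of_nat (f x) - of_nat (g x)) * A"
proof -
  have inj: "inj_on T \<mu>" using SYT_bij[OF T] by (simp add: bij_betw_def)
  have "{1..<T x} = T ` {y \<in> \<mu>. T y < T x}"
  proof (intro subset_antisym subsetI)
    fix j assume "j \<in> {1..<T x}"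
    moreover then obtain y where "y \<in> \<mu>" "T y = j" using SYT_surj[OF T, of j] SYT_range[OF T x] by auto
    ultimately show "j \<in> T ` {y \<in> \<mu>. T y < T x}" by auto
  qed (use SYT_range[OF T] in auto)
  then have "(\<Sum>j\<in>{1..<T x}. F j) = (\<Sum>y\<in>{y \<in> \<mu>. T y < T x}. F (T y))"
    by (simp add: sum.reindex[OF inj_on_subset[OF inj]])
  also have "{y \<in> \<mu>. T y < T x} = {y \<in> \<mu>. f y < f x} \<union> {y \<in> \<mu>. f y = f x \<and> g y < g x}"
    using order by auto
  also have "(\<Sum>y\<in>\<dots>. F (T y)) =
      (\<Sum>y\<in>{y \<in> \<mu>. f y < f x}. F (T y)) + (\<Sum>y\<in>{y \<in> \<mu>. f y = f x \<and> g y < g x}. F (T y))"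
    by (rule sum.union_disjoint) (use fin in auto)
  also have "(\<Sum>y\<in>{y \<in> \<mu>. f y = f x \<and> g y < g x}. F (T y)) = - of_nat (g x - 1) * A"
    using part by (simp add: card)
  also have "(\<Sum>y\<in>{y \<in> \<mu>. f y < f x}. F (T y)) =
      (\<Sum>c\<in>{1..<f x}. \<Sum>y\<in>{y \<in> {y \<in> \<mu>. f y < f x}. f y = c}. F (T y))"
    by (rule sum.group[symmetric]) (use fin pos in auto)
  also have "\<dots> = (\<Sum>c\<in>{1..<f x}. A)"
  proof (rule sum.cong[OF refl])
    fix c assume c: "c \<in> {1..<f x}"
    then have "{y \<in> {y \<in> \<mu>. f y < f x}. f y = c} = {y \<in> \<mu>. f y = c}" by auto
    then show "(\<Sum>y\<in>{y \<in> {y \<in> \<mu>. f y < f x}. f y = c}. F (T y)) = A"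
      using full[of c] c by (simp add: sum.reindex[OF inj_on_subset[OF inj]])
  qed
  also have "\<dots> = of_nat (f x - 1) * A" by simp
  finally show ?thesis using pos x by (simp add: of_nat_diff algebra_simps)
qed

text \<open>
  The vector is \<open>b w a\<close>, where \<open>b\<close> is the column antisymmetrizer of \<open>S\<close>, \<open>a\<close> the row
  symmetrizer of \<open>T\<close>, and \<open>w\<close> the permutation that carries \<open>T\<close> to \<open>S\<close>. Its coefficient at
  \<open>p\<close> is the sum of the signs of those \<open>\<sigma>\<close> in the column group \<open>H\<close> of \<open>S\<close> for which
  \<open>\<sigma> \<circ> p\<close> maps each row of \<open>T\<close> to the same row of \<open>S\<close>.

  For the left eigenvalues, each complete column before the entry \<open>S x\<close> contributes \<open>1\<close> by
  a Garnir relation and each entry above it in its own column contributes \<open>-1\<close> by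
  antisymmetry. For the right eigenvalues, each complete row before \<open>T x\<close> contributes \<open>-1\<close>
  and each entry to the left of it in its own row contributes \<open>1\<close>. Both sums are contents.
\<close>

lemma bi_weight_vector_reading:
  assumes Y: "young_diagram \<mu>" and S: "S \<in> SYT \<mu>" and T: "T \<in> SYT \<mu>"
    and order_S: "\<And>x y. x \<in> \<mu> \<Longrightarrow> y \<in> \<mu> \<Longrightarrow>
      S x < S y \<longleftrightarrow> snd x < snd y \<or> snd x = snd y \<and> fst x < fst y"
    and order_T: "\<And>x y. x \<in> \<mu> \<Longrightarrow> y \<in> \<mu> \<Longrightarrow>
      T x < T y \<longleftrightarrow> fst x < fst y \<or> fst x = fst y \<and> snd x < snd y"
  shows "\<exists>v. bi_weight_vector \<mu> S T v"
proof -
  let ?A = "{1..card \<mu>}"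
  note fin = young_diagram_finite[OF Y]
  define boxS boxT where "boxS = inv_into \<mu> S" and "boxT = inv_into \<mu> T"
  have box: "boxS (S x) = x" "boxT (T x) = x" if "x \<in> \<mu>" for x
    using that SYT_bij[OF S] SYT_bij[OF T] by (auto simp: boxS_def boxT_def bij_betw_def)
  have boxS: "boxS i \<in> \<mu>" "S (boxS i) = i" if "i \<in> ?A" for i
    using that SYT_bij[OF S] unfolding boxS_def bij_betw_def
    by (auto intro: inv_into_into f_inv_into_f)
  have boxT: "boxT i \<in> \<mu>" "T (boxT i) = i" if "i \<in> ?A" for i
    using that SYT_bij[OF T] unfolding boxT_def bij_betw_def
    by (auto intro: inv_into_into f_inv_into_f)
  have rng: "S x \<in> ?A" "T x \<in> ?A" if "x \<in> \<mu>" for x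
    using SYT_range[OF S that] SYT_range[OF T that] by auto
  define rS cS rT where "rS = fst \<circ> boxS" and "cS = snd \<circ> boxS" and "rT = fst \<circ> boxT"
  define H where "H = {\<sigma>. \<sigma> permutes ?A \<and> (\<forall>i\<in>?A. cS (\<sigma> i) = cS i)}"
  define M where "M p = {\<sigma> \<in> H. \<forall>i\<in>?A. rS (\<sigma> (p i)) = rT i}" for p
  define v where "v p = (\<Sum>\<sigma>\<in>M p. of_int (sign \<sigma>) :: rat)" for p
  have mem: "p i \<in> ?A \<longleftrightarrow> i \<in> ?A" "pinv p i \<in> ?A \<longleftrightarrow> i \<in> ?A" if "p permutes ?A" for p i
    using that permutes_in_image[OF that] permutes_in_image[OF permutes_inv[OF that]] by blast+
  have pi: "p (pinv p i) = i" "pinv p (p i) = i" if "p permutes ?A" for p i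
    by (rule permutes_inverses[OF that])+

  have col_anti: "v (transpose a b \<circ> p) = - v p"
    if p: "p permutes ?A" and ab: "a \<in> ?A" "b \<in> ?A" "a \<noteq> b" "cS a = cS b" for p a b
  proof -
    let ?t = "transpose a b"
    have t: "?t permutes ?A" by (rule permutes_swap_id) (use ab in auto)
    have ct: "cS (?t i) = cS i" for i using ab by (auto simp: transpose_def)
    have step: "\<sigma> \<circ> ?t \<in> M q" if "\<sigma> \<in> M (?t \<circ> q)" for \<sigma> q
      using that t mem(1)[OF t] ct unfolding M_def H_def
      by (auto intro: permutes_compose simp del: atLeastAtMost_iff)
    have tt: "?t \<circ> (?t \<circ> p) = p" "\<sigma> \<circ> ?t \<circ> ?t = \<sigma>" for \<sigma> by (simp_all add: comp_assoc flip: comp_assoc[of ?t ?t])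
    have "v (?t \<circ> p) = (\<Sum>\<sigma>\<in>M p. of_int (sign (\<sigma> \<circ> ?t)))"
      unfolding v_def
      by (rule sum.reindex_bij_witness[where i = "\<lambda>\<sigma>. \<sigma> \<circ> ?t" and j = "\<lambda>\<sigma>. \<sigma> \<circ> ?t"])
        (use step[of _ p] step[of _ "?t \<circ> p"] in \<open>auto simp: tt\<close>)
    also have "\<dots> = (\<Sum>\<sigma>\<in>M p. - of_int (sign \<sigma>))"
    proof (rule sum.cong[OF refl])
      fix \<sigma> assume "\<sigma> \<in> M p"
      then have "permutation \<sigma>" by (auto simp: M_def H_def permutation_permutes)
      then show "of_int (sign (\<sigma> \<circ> ?t)) = - (of_int (sign \<sigma>) :: rat)"
        using ab by (simp add: sign_compose permutation_swap_id sign_swap_id)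
    qed
    finally show ?thesis by (simp add: v_def sum_negf)
  qed

  have row_sym: "v (p \<circ> transpose a b) = v p"
    if ab: "a \<in> ?A" "b \<in> ?A" "rT a = rT b" for p a b
  proof -
    let ?t = "transpose a b"
    have t: "?t permutes ?A" by (rule permutes_swap_id) (use ab in auto)
    have rt: "rT (?t i) = rT i" for i using ab by (auto simp: transpose_def)
    have "(\<forall>i\<in>?A. rS (\<sigma> ((p \<circ> ?t) i)) = rT i) \<longleftrightarrow> (\<forall>i\<in>?A. rS (\<sigma> (p i)) = rT i)" for \<sigma>
    proof -
      have "(\<forall>i\<in>?A. rS (\<sigma> ((p \<circ> ?t) i)) = rT i) \<longleftrightarrow> (\<forall>i\<in>?t ` ?A. rS (\<sigma> (p i)) = rT i)"
        using rt by (simp del: transpose_image_eq)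
      then show ?thesis unfolding permutes_image[OF t] .
    qed
    then show ?thesis unfolding v_def M_def by simp
  qed

  have left: "has_weight \<mu> S v"
    unfolding has_weight_def
  proof (intro ballI allI impI)
    fix x p assume x: "x \<in> \<mu>" and p: "p permutes ?A"
    obtain r c where rc: "x = (r, c)" by fastforce
    have rc1: "1 \<le> r" "1 \<le> c" using young_diagram_pos[OF Y] x rc by auto
    have "jucys_murphy (S x) v p = (of_nat (snd x) - of_nat (fst x)) * v p"
      unfolding jucys_murphy_def
    proof (rule reading_order_sum[OF S fin x])
      fix c0 assume c0: "1 \<le> c0" "c0 < snd x"
      let ?C = "S ` {y \<in> \<mu>. snd y = c0}"
      have C: "a \<in> ?A" "cS a = c0" if "a \<in> ?C" for a using that rng by (auto simp: cS_def box)
      have "(\<Sum>a\<in>?C. v (transpose a (S x) \<circ> p)) = 1 * v p"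
      proof (rule garnir_relation[where A = ?A and key = rT])
        show "S x \<notin> ?C" using C(2)[of "S x"] c0 x by (auto simp: cS_def box)
        show "v (transpose a b \<circ> q) = - 1 * v q"
          if "q permutes ?A" "a \<in> ?C" "b \<in> ?C" "a \<noteq> b" for a b q
          using col_anti[of q a b] that C[of a] C[of b] by simp
        show "v (transpose a b \<circ> q) = 1 * v q"
          if q: "q permutes ?A" and ab: "a \<in> insert (S x) ?C" "b \<in> insert (S x) ?C" "a \<noteq> b"
            "rT (pinv q a) = rT (pinv q b)" for a b q
        proof -
          have m: "a \<in> ?A" "b \<in> ?A" using ab C(1) rng x by blast+
          have "transpose a b \<circ> q = q \<circ> transpose (pinv q a) (pinv q b)"
            using conjugate_transpose[OF permutes_inj[OF q], of "pinv q a" "pinv q b"] by (simp add: pi[OF q])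
          then show ?thesis using row_sym[of "pinv q a" "pinv q b" q] m ab mem(2)[OF q] by simp
        qed
        show "\<exists>a\<in>?C. rT (pinv q a) = rT (pinv q (S x))" if q: "q permutes ?A" and nz: "v q \<noteq> 0" for q
        proof -
          have "M q \<noteq> {}" using nz unfolding v_def by auto
          then obtain \<sigma> where s: "\<sigma> permutes ?A" "\<forall>i\<in>?A. cS (\<sigma> i) = cS i"
            and r: "\<forall>i\<in>?A. rS (\<sigma> (q i)) = rT i" by (auto simp: M_def H_def)
          have rT: "rT (pinv q j) = rS (\<sigma> j)" if "j \<in> ?A" for j
            using r mem(2)[OF q, of j] that by (auto simp: pi[OF q] simp del: atLeastAtMost_iff)
          \<comment> \<open>The row of \<open>\<sigma> (S x)\<close> also meets the earlier column \<open>c0\<close>, in a box of \<open>\<sigma> a\<close>.\<close>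
          let ?y = "boxS (\<sigma> (S x))"
          have sx: "\<sigma> (S x) \<in> ?A" using mem(1)[OF s(1)] rng(1)[OF x] by blast
          have y: "?y \<in> \<mu>" using boxS(1)[OF sx] .
          have "snd ?y = snd x" using s(2) rng(1)[OF x] x by (auto simp: cS_def box)
          then have "c0 \<le> snd ?y" using c0 by simp
          moreover have "(fst ?y, snd ?y) \<in> \<mu>" using y by simp
          ultimately have z: "(fst ?y, c0) \<in> \<mu>"
            using young_diagram_mono[OF Y _ _ order_refl c0(1)] young_diagram_pos(1)[OF Y] by blast
          define a where "a = pinv \<sigma> (S (fst ?y, c0))"
          have a: "a \<in> ?A" "\<sigma> a = S (fst ?y, c0)"
            using mem(2)[OF s(1)] rng(1)[OF z] pi[OF s(1)] by (auto simp: a_def simp del: atLeastAtMost_iff)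
          have "cS a = c0" using s(2) a z by (metis box(1) comp_apply cS_def snd_conv)
          then have "S (boxS a) \<in> ?C" by (intro imageI) (use boxS(1)[OF a(1)] in \<open>simp add: cS_def\<close>)
          then have "a \<in> ?C" by (simp only: boxS(2)[OF a(1)])
          moreover have "rT (pinv q a) = rT (pinv q (S x))"
            unfolding rT[OF a(1)] rT[OF rng(1)[OF x]] a(2) using z by (simp add: rS_def box)
          ultimately show ?thesis by blast
        qed
      qed (use C rng x p fin in auto)
      then show "(\<Sum>a\<in>?C. v (transpose a (S x) \<circ> p)) = v p" by simp
    next
      fix y assume y: "y \<in> \<mu>" "snd y = snd x" "fst y < fst x"
      then have "S y \<noteq> S x" using SYT_inj[OF S y(1) x] by auto
      then show "v (transpose (S y) (S x) \<circ> p) = - v p"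
        by (intro col_anti p rng x y) (use x y in \<open>auto simp: cS_def box\<close>)
    next
      have "{y \<in> \<mu>. snd y = snd x \<and> fst y < fst x} = (\<lambda>i. (i, c)) ` {1..<r}"
        using young_diagram_mono[OF Y, of r c _ c] x rc1 young_diagram_pos[OF Y] by (fastforce simp: rc)
      then show "card {y \<in> \<mu>. snd y = snd x \<and> fst y < fst x} = fst x - 1"
        by (simp add: card_image inj_on_def rc)
    qed (use order_S x young_diagram_pos[OF Y] rc rc1 in auto)
    then show "jucys_murphy (S x) v p = of_int (box_content x) * v p" by (simp add: box_content_def)
  qed

  have right: "has_weight \<mu> T (\<lambda>p. v (pinv p))"
    unfolding has_weight_def
  proof (intro ballI allI impI)
    fix x p assume x: "x \<in> \<mu>" and p: "p permutes ?A"
    let ?u = "\<lambda>p. v (pinv p)"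
    have u: "?u (transpose a b \<circ> q) = v (pinv q \<circ> transpose a b)" if "q permutes ?A" for a b q
      by (simp add: inv_transpose_comp[OF that])
    obtain r c where rc: "x = (r, c)" by fastforce
    have rc1: "1 \<le> r" "1 \<le> c" using young_diagram_pos[OF Y] x rc by auto
    have "jucys_murphy (T x) ?u p = (of_nat (fst x) - of_nat (snd x)) * (- ?u p)"
      unfolding jucys_murphy_def
    proof (rule reading_order_sum[OF T fin x])
      fix r0 assume r0: "1 \<le> r0" "r0 < fst x"
      let ?R = "T ` {y \<in> \<mu>. fst y = r0}"
      have R: "a \<in> ?A" "rT a = r0" if "a \<in> ?R" for a using that rng by (auto simp: rT_def box)
      have "(\<Sum>a\<in>?R. ?u (transpose a (T x) \<circ> p)) = - 1 * ?u p"
      proof (rule garnir_relation[where A = ?A and key = cS])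
        show "T x \<notin> ?R" using R(2)[of "T x"] r0 x by (auto simp: rT_def box)
        show "?u (transpose a b \<circ> q) = - (- 1) * ?u q"
          if "q permutes ?A" "a \<in> ?R" "b \<in> ?R" "a \<noteq> b" for a b q
          unfolding u[OF that(1)] using row_sym[of a b "pinv q"] that R[of a] R[of b] by simp
        show "?u (transpose a b \<circ> q) = - 1 * ?u q"
          if q: "q permutes ?A" and ab: "a \<in> insert (T x) ?R" "b \<in> insert (T x) ?R" "a \<noteq> b"
            "cS (pinv q a) = cS (pinv q b)" for a b q
        proof -
          have m: "a \<in> ?A" "b \<in> ?A" using ab R(1) rng x by blast+
          have q': "pinv q permutes ?A" using permutes_inv[OF q] .
          have ne: "pinv q a \<noteq> pinv q b" using ab(3) pi(1)[OF q] by metis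
          have "pinv q \<circ> transpose a b = transpose (pinv q a) (pinv q b) \<circ> pinv q"
            using conjugate_transpose[OF permutes_inj[OF q']] .
          then show ?thesis
            unfolding u[OF q] using col_anti[OF q' _ _ ne ab(4)] m mem(2)[OF q] by simp
        qed
        show "\<exists>a\<in>?R. cS (pinv q a) = cS (pinv q (T x))" if q: "q permutes ?A" and nz: "?u q \<noteq> 0" for q
        proof -
          have "M (pinv q) \<noteq> {}" using nz unfolding v_def by auto
          then obtain \<sigma> where s: "\<sigma> permutes ?A" "\<forall>i\<in>?A. cS (\<sigma> i) = cS i"
            and r: "\<forall>i\<in>?A. rS (\<sigma> (pinv q i)) = rT i" by (auto simp: M_def H_def)
          have qx: "pinv q (T x) \<in> ?A" using mem(2)[OF q] rng(2)[OF x] by blast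
          have sx: "\<sigma> (pinv q (T x)) \<in> ?A" using mem(1)[OF s(1)] qx by blast
          \<comment> \<open>The column of this box also meets the earlier row \<open>r0\<close>, in a box of \<open>\<sigma> w\<close>.\<close>
          let ?y = "boxS (\<sigma> (pinv q (T x)))"
          have y: "?y \<in> \<mu>" using boxS(1)[OF sx] .
          have "fst ?y = fst x" using r rng(2)[OF x] x by (auto simp: rS_def rT_def box)
          then have "r0 \<le> fst ?y" using r0 by simp
          moreover have "(fst ?y, snd ?y) \<in> \<mu>" using y by simp
          ultimately have z: "(r0, snd ?y) \<in> \<mu>"
            using young_diagram_mono[OF Y _ r0(1) _ _ order_refl] young_diagram_pos(2)[OF Y] by blast
          define w where "w = pinv \<sigma> (S (r0, snd ?y))"
          have w: "w \<in> ?A" "\<sigma> w = S (r0, snd ?y)"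
            using mem(2)[OF s(1)] rng(1)[OF z] pi[OF s(1)] by (auto simp: w_def simp del: atLeastAtMost_iff)
          have "cS w = snd ?y" using s(2) w z by (metis box(1) comp_apply cS_def snd_conv)
          also have "\<dots> = cS (pinv q (T x))" using s(2) qx by (auto simp: cS_def)
          finally have cw: "cS (pinv q (q w)) = cS (pinv q (T x))" by (simp add: pi[OF q])
          have qw: "q w \<in> ?A" using mem(1)[OF q] w(1) by blast
          have "rT (q w) = rS (\<sigma> (pinv q (q w)))" using r qw by (metis)
          also have "\<dots> = r0" using z by (simp add: pi[OF q] w(2) rS_def box)
          finally have "T (boxT (q w)) \<in> ?R" by (intro imageI) (use boxT(1)[OF qw] in \<open>simp add: rT_def\<close>)
          then have "q w \<in> ?R" by (simp only: boxT(2)[OF qw])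
          with cw show ?thesis by blast
        qed
      qed (use R rng x p fin in auto)
      then show "(\<Sum>a\<in>?R. ?u (transpose a (T x) \<circ> p)) = - ?u p" by simp
    next
      fix y assume y: "y \<in> \<mu>" "fst y = fst x" "snd y < snd x"
      have "v (pinv p \<circ> transpose (T y) (T x)) = v (pinv p)"
        by (intro row_sym rng x y) (use x y in \<open>auto simp: rT_def box\<close>)
      then show "?u (transpose (T y) (T x) \<circ> p) = - (- ?u p)" by (simp add: u[OF p])
    next
      have "{y \<in> \<mu>. fst y = fst x \<and> snd y < snd x} = (\<lambda>j. (r, j)) ` {1..<c}"
        using young_diagram_mono[OF Y, of r c r] x rc1 young_diagram_pos[OF Y] by (fastforce simp: rc)
      then show "card {y \<in> \<mu>. fst y = fst x \<and> snd y < snd x} = snd x - 1"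
        by (simp add: card_image inj_on_def rc)
    qed (use order_T x young_diagram_pos[OF Y] rc rc1 in auto)
    then show "jucys_murphy (T x) ?u p = of_int (box_content x) * ?u p"
      by (simp add: box_content_def algebra_simps)
  qed

  \<comment> \<open>At \<open>w\<close> only the identity contributes: it alone preserves both rows and columns.\<close>
  have "\<exists>w. w permutes ?A \<and> v w \<noteq> 0"
  proof -
    define w where "w i = (if i \<in> ?A then S (boxT i) else i)" for i
    have "bij_betw (S \<circ> boxT) ?A ?A"
      using bij_betw_trans[OF bij_betw_inv_into[OF SYT_bij[OF T]] SYT_bij[OF S]] by (simp add: boxT_def)
    then have "bij_betw w ?A ?A" by (subst bij_betw_cong[of _ _ "S \<circ> boxT"]) (auto simp: w_def)
    then have w: "w permutes ?A" by (rule bij_imp_permutes) (auto simp: w_def)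
    have rw: "rS (w i) = rT i" if "i \<in> ?A" for i
      using that boxT(1)[OF that] by (simp add: w_def rS_def rT_def box)
    have "M w = {id}"
    proof (intro subset_antisym subsetI)
      fix \<sigma> assume "\<sigma> \<in> M w"
      then have s: "\<sigma> permutes ?A" "\<forall>i\<in>?A. cS (\<sigma> i) = cS i" "\<forall>i\<in>?A. rS (\<sigma> (w i)) = rT i"
        by (auto simp: M_def H_def)
      have "\<sigma> j = j" for j
      proof (cases "j \<in> ?A")
        case True
        then have j: "pinv w j \<in> ?A" "w (pinv w j) = j" using mem(2)[OF w] pi[OF w] by auto
        have "rS (\<sigma> j) = rS j" using s(3) rw j by metis
        moreover have "cS (\<sigma> j) = cS j" using s(2) True by blast
        ultimately have "boxS (\<sigma> j) = boxS j" by (simp add: rS_def cS_def prod_eq_iff)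
        then show ?thesis using boxS(2) mem(1)[OF s(1), of j] True by metis
      qed (use s(1) permutes_not_in in metis)
      then show "\<sigma> \<in> {id}" by auto
    qed (use rw permutes_id in \<open>auto simp: M_def H_def\<close>)
    then have "v w = 1" by (simp add: v_def)
    then show ?thesis using w by auto
  qed
  then show ?thesis using left right unfolding bi_weight_vector_def by blast
qed

lemma bi_weight_vector_exists:
  assumes "young_diagram \<mu>" "S \<in> SYT \<mu>" "T \<in> SYT \<mu>"
  shows "\<exists>v. bi_weight_vector \<mu> S T v"
proof -
  show ?thesis
  proof (rule reading_tableaux[OF assms(1)])
    fix S0 T0
    assume S0: "S0 \<in> SYT \<mu>"
      "\<And>x y. x \<in> \<mu> \<Longrightarrow> y \<in> \<mu> \<Longrightarrow> S0 x < S0 y \<longleftrightarrow> snd x < snd y \<or> snd x = snd y \<and> fst x < fst y"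
    assume T0: "T0 \<in> SYT \<mu>"
      "\<And>x y. x \<in> \<mu> \<Longrightarrow> y \<in> \<mu> \<Longrightarrow> T0 x < T0 y \<longleftrightarrow> fst x < fst y \<or> fst x = fst y \<and> snd x < snd y"
    have "\<exists>v. bi_weight_vector \<mu> S0 T0 v"
      by (rule bi_weight_vector_reading[OF assms(1) S0(1) T0(1) S0(2) T0(2)])
    then show ?thesis using bi_weight_vector_exists_all[OF assms(1) S0(1) T0(1) assms(2,3)] by blast
  qed
qed

section \<open>Factorization of the cycle polynomial\<close>

text \<open>
  There are \<open>N\<close> to the number of cycles of \<open>\<sigma>\<close> such colourings.
\<close>

definition fixed_colourings :: "nat \<Rightarrow> nat \<Rightarrow> (nat \<Rightarrow> nat) \<Rightarrow> (nat \<Rightarrow> nat) set" where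
  "fixed_colourings m N \<sigma> = {h \<in> {1..m} \<rightarrow>\<^sub>E {..<N}. \<forall>i\<in>{1..m}. h (\<sigma> i) = h i}"

text \<open>
  The new fixed point \<open>m + 1\<close> can take any colour.
\<close>

lemma card_fixed_colourings_fixpoint:
  assumes \<sigma>: "\<sigma> permutes {1..m}"
  shows "card (fixed_colourings (Suc m) N \<sigma>) = N * card (fixed_colourings m N \<sigma>)"
proof -
  have last: "\<sigma> (Suc m) = Suc m" using \<sigma> by (auto intro: permutes_not_in)
  have mem: "\<sigma> i \<in> {1..m} \<longleftrightarrow> i \<in> {1..m}" for i by (rule permutes_in_image[OF \<sigma>])
  have range: "{1..Suc m} = insert (Suc m) {1..m}" by auto
  have "bij_betw (\<lambda>(h, c). h(Suc m := c)) (fixed_colourings m N \<sigma> \<times> {..<N}) (fixed_colourings (Suc m) N \<sigma>)"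
  proof (rule bij_betw_byWitness[where f' = "\<lambda>h. (restrict h {1..m}, h (Suc m))"])
    show "\<forall>hc\<in>fixed_colourings m N \<sigma> \<times> {..<N}.
        (\<lambda>h. (restrict h {1..m}, h (Suc m))) ((\<lambda>(h, c). h(Suc m := c)) hc) = hc"
      by (auto simp: fixed_colourings_def fun_eq_iff PiE_iff extensional_def)
    show "\<forall>h\<in>fixed_colourings (Suc m) N \<sigma>.
        (\<lambda>(h, c). h(Suc m := c)) ((\<lambda>h. (restrict h {1..m}, h (Suc m))) h) = h"
      by (auto simp: fixed_colourings_def fun_eq_iff PiE_iff extensional_def)
    show "(\<lambda>(h, c). h(Suc m := c)) ` (fixed_colourings m N \<sigma> \<times> {..<N}) \<subseteq> fixed_colourings (Suc m) N \<sigma>"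
    proof clarify
      fix h c assume h: "h \<in> fixed_colourings m N \<sigma>" and c: "c < N"
      have "h(Suc m := c) \<in> {1..Suc m} \<rightarrow>\<^sub>E {..<N}"
        unfolding range by (rule PiE_fun_upd) (use h c in \<open>simp_all add: fixed_colourings_def\<close>)
      moreover have "(h(Suc m := c)) (\<sigma> i) = (h(Suc m := c)) i" if "i \<in> {1..Suc m}" for i
        using h last mem[of i] that unfolding fixed_colourings_def range by auto
      ultimately show "h(Suc m := c) \<in> fixed_colourings (Suc m) N \<sigma>"
        by (simp add: fixed_colourings_def)
    qed
    show "(\<lambda>h. (restrict h {1..m}, h (Suc m))) ` fixed_colourings (Suc m) N \<sigma> \<subseteq> fixed_colourings m N \<sigma> \<times> {..<N}"
    proof (rule image_subsetI)
      fix h assume h: "h \<in> fixed_colourings (Suc m) N \<sigma>"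
      have "restrict h {1..m} (\<sigma> i) = restrict h {1..m} i" if "i \<in> {1..m}" for i
        using h that mem[of i] unfolding fixed_colourings_def range by auto
      moreover have "restrict h {1..m} \<in> {1..m} \<rightarrow>\<^sub>E {..<N}"
        using h unfolding fixed_colourings_def range by auto
      moreover have "h (Suc m) < N" using h unfolding fixed_colourings_def range by auto
      ultimately show "(restrict h {1..m}, h (Suc m)) \<in> fixed_colourings m N \<sigma> \<times> {..<N}"
        by (simp add: fixed_colourings_def)
    qed
  qed
  then show ?thesis by (simp add: bij_betw_same_card[symmetric] card_cartesian_product)
qed

text \<open>
  Here \<open>m + 1\<close> is inserted into the cycle of \<open>b\<close> and must take the colour of \<open>b\<close>.
\<close>

lemma card_fixed_colourings_transpose:
  assumes \<sigma>: "\<sigma> permutes {1..m}" and b: "b \<in> {1..m}"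
  shows "card (fixed_colourings (Suc m) N (transpose (Suc m) b \<circ> \<sigma>)) = card (fixed_colourings m N \<sigma>)"
proof -
  let ?t = "transpose (Suc m) b"
  have last: "\<sigma> (Suc m) = Suc m" using \<sigma> by (auto intro: permutes_not_in)
  have mem: "\<sigma> i \<in> {1..m} \<longleftrightarrow> i \<in> {1..m}" for i by (rule permutes_in_image[OF \<sigma>])
  have range: "{1..Suc m} = insert (Suc m) {1..m}" by auto
  have inv: "h (Suc m) = h b" "\<And>i. i \<in> {1..m} \<Longrightarrow> h (\<sigma> i) = h i"
    if "h \<in> fixed_colourings (Suc m) N (?t \<circ> \<sigma>)" for h
  proof -
    have *: "h (?t (\<sigma> i)) = h i" if "i \<in> {1..Suc m}" for i
      using that \<open>h \<in> _\<close> by (simp add: fixed_colourings_def)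
    show 1: "h (Suc m) = h b" using *[of "Suc m"] last by simp
    then have "h (?t j) = h j" for j by (auto simp: transpose_def)
    then show "h (\<sigma> i) = h i" if "i \<in> {1..m}" for i using *[of i] that by simp
  qed
  have "bij_betw (\<lambda>h. h(Suc m := h b)) (fixed_colourings m N \<sigma>) (fixed_colourings (Suc m) N (?t \<circ> \<sigma>))"
  proof (rule bij_betw_byWitness[where f' = "\<lambda>h. restrict h {1..m}"])
    show "\<forall>h\<in>fixed_colourings m N \<sigma>. restrict (h(Suc m := h b)) {1..m} = h"
      by (auto simp: fixed_colourings_def fun_eq_iff PiE_iff extensional_def)
    show "\<forall>h\<in>fixed_colourings (Suc m) N (?t \<circ> \<sigma>). (restrict h {1..m})(Suc m := restrict h {1..m} b) = h"
    proof
      fix h assume h: "h \<in> fixed_colourings (Suc m) N (?t \<circ> \<sigma>)"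
      then show "(restrict h {1..m})(Suc m := restrict h {1..m} b) = h"
        using inv(1)[OF h] b by (auto simp: fixed_colourings_def fun_eq_iff PiE_iff extensional_def)
    qed
    show "(\<lambda>h. h(Suc m := h b)) ` fixed_colourings m N \<sigma> \<subseteq> fixed_colourings (Suc m) N (?t \<circ> \<sigma>)"
    proof clarify
      fix h assume h: "h \<in> fixed_colourings m N \<sigma>"
      let ?h = "h(Suc m := h b)"
      have "?h \<in> {1..Suc m} \<rightarrow>\<^sub>E {..<N}"
        unfolding range by (rule PiE_fun_upd) (use h b in \<open>auto simp: fixed_colourings_def\<close>)
      moreover have "?h (?t j) = ?h j" for j using b by (auto simp: transpose_def)
      moreover have "?h (\<sigma> i) = ?h i" if "i \<in> {1..Suc m}" for i
        using h last mem[of i] that unfolding fixed_colourings_def range by auto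
      ultimately show "?h \<in> fixed_colourings (Suc m) N (?t \<circ> \<sigma>)"
        by (simp add: fixed_colourings_def del: fun_upd_apply)
    qed
    show "(\<lambda>h. restrict h {1..m}) ` fixed_colourings (Suc m) N (?t \<circ> \<sigma>) \<subseteq> fixed_colourings m N \<sigma>"
    proof clarify
      fix h assume h: "h \<in> fixed_colourings (Suc m) N (?t \<circ> \<sigma>)"
      have "restrict h {1..m} (\<sigma> i) = restrict h {1..m} i" if "i \<in> {1..m}" for i
        using inv(2)[OF h that] that mem[of i] by simp
      moreover have "restrict h {1..m} \<in> {1..m} \<rightarrow>\<^sub>E {..<N}"
        using h unfolding fixed_colourings_def range by auto
      ultimately show "restrict h {1..m} \<in> fixed_colourings m N \<sigma>"
        by (simp add: fixed_colourings_def)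
    qed
  qed
  then show ?thesis by (simp add: bij_betw_same_card)
qed

text \<open>
  Every permutation of \<open>{1..r + 1}\<close> is uniquely \<open>(r + 1  b) \<circ> \<sigma>\<close> with \<open>\<sigma>\<close> a permutation of
  \<open>{1..r}\<close> and \<open>b \<le> r + 1\<close>. The case \<open>b = r + 1\<close> yields the factor \<open>N\<close>, the other cases
  together yield \<open>J\<^sub>r\<^sub>+\<^sub>1\<close>.
\<close>

lemma sum_fixed_colourings_eigenvector:
  fixes v :: "(nat \<Rightarrow> nat) \<Rightarrow> rat"
  assumes eig: "\<And>l p. l \<in> {1..m} \<Longrightarrow> p permutes {1..m} \<Longrightarrow> jucys_murphy l v p = a l * v p"
    and "r \<le> m" and "p permutes {1..m}"
  shows "(\<Sum>\<sigma> | \<sigma> permutes {1..r}. of_nat (card (fixed_colourings r N \<sigma>)) * v (\<sigma> \<circ> p)) =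
    (\<Prod>l\<in>{1..r}. of_nat N + a l) * v p"
  using assms(2)
proof (induction r)
  case 0
  have "fixed_colourings 0 N \<sigma> = {\<lambda>x. undefined}" for \<sigma> by (auto simp: fixed_colourings_def)
  then show ?case by simp
next
  case (Suc r)
  have range: "{1..Suc r} = insert (Suc r) {1..r}" by auto
  let ?c = "\<lambda>\<sigma>. of_nat (card (fixed_colourings r N \<sigma>)) :: rat"
  let ?c' = "\<lambda>\<sigma>. of_nat (card (fixed_colourings (Suc r) N \<sigma>)) :: rat"
  let ?P = "{\<sigma>. \<sigma> permutes {1..r}}"
  have perm: "\<sigma> \<circ> p permutes {1..m}" if "\<sigma> \<in> ?P" for \<sigma>
  proof -
    have "\<sigma> permutes {1..m}" by (rule permutes_subset[of \<sigma> "{1..r}"]) (use that Suc.prems in auto)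
    then show ?thesis by (rule permutes_compose[OF assms(3)])
  qed
  have "(\<Sum>\<sigma> | \<sigma> permutes {1..Suc r}. ?c' \<sigma> * v (\<sigma> \<circ> p)) =
      (\<Sum>b\<in>insert (Suc r) {1..r}. \<Sum>\<sigma>\<in>?P. ?c' (transpose (Suc r) b \<circ> \<sigma>) * v (transpose (Suc r) b \<circ> \<sigma> \<circ> p))"
    unfolding range by (rule sum_over_permutations_insert) auto
  also have "\<dots> = (\<Sum>\<sigma>\<in>?P. ?c' \<sigma> * v (\<sigma> \<circ> p)) +
      (\<Sum>b\<in>{1..r}. \<Sum>\<sigma>\<in>?P. ?c' (transpose (Suc r) b \<circ> \<sigma>) * v (transpose (Suc r) b \<circ> \<sigma> \<circ> p))"
    by simp
  also have "(\<Sum>\<sigma>\<in>?P. ?c' \<sigma> * v (\<sigma> \<circ> p)) = (\<Sum>\<sigma>\<in>?P. of_nat N * (?c \<sigma> * v (\<sigma> \<circ> p)))"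
    by (rule sum.cong) (auto simp: card_fixed_colourings_fixpoint)
  also have "(\<Sum>b\<in>{1..r}. \<Sum>\<sigma>\<in>?P. ?c' (transpose (Suc r) b \<circ> \<sigma>) * v (transpose (Suc r) b \<circ> \<sigma> \<circ> p)) =
      (\<Sum>b\<in>{1..r}. \<Sum>\<sigma>\<in>?P. ?c \<sigma> * v (transpose b (Suc r) \<circ> (\<sigma> \<circ> p)))"
  proof (intro sum.cong refl)
    fix b \<sigma> assume "b \<in> {1..r}" "\<sigma> \<in> ?P"
    then have "?c' (transpose (Suc r) b \<circ> \<sigma>) = ?c \<sigma>" by (simp add: card_fixed_colourings_transpose)
    moreover have "transpose (Suc r) b \<circ> \<sigma> \<circ> p = transpose b (Suc r) \<circ> (\<sigma> \<circ> p)"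
      by (simp only: comp_assoc transpose_commute)
    ultimately show "?c' (transpose (Suc r) b \<circ> \<sigma>) * v (transpose (Suc r) b \<circ> \<sigma> \<circ> p) =
        ?c \<sigma> * v (transpose b (Suc r) \<circ> (\<sigma> \<circ> p))"
      by (simp only:)
  qed
  also have "\<dots> = (\<Sum>\<sigma>\<in>?P. ?c \<sigma> * jucys_murphy (Suc r) v (\<sigma> \<circ> p))"
    by (subst sum.swap) (simp add: jucys_murphy_def sum_distrib_left atLeastLessThanSuc_atLeastAtMost)
  also have "\<dots> = (\<Sum>\<sigma>\<in>?P. a (Suc r) * (?c \<sigma> * v (\<sigma> \<circ> p)))"
  proof (rule sum.cong[OF refl])
    fix \<sigma> assume "\<sigma> \<in> ?P"
    then have "jucys_murphy (Suc r) v (\<sigma> \<circ> p) = a (Suc r) * v (\<sigma> \<circ> p)"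
      using Suc.prems by (intro eig perm) auto
    then show "?c \<sigma> * jucys_murphy (Suc r) v (\<sigma> \<circ> p) = a (Suc r) * (?c \<sigma> * v (\<sigma> \<circ> p))"
      by (simp only: mult.left_commute)
  qed
  finally have "(\<Sum>\<sigma> | \<sigma> permutes {1..Suc r}. ?c' \<sigma> * v (\<sigma> \<circ> p)) =
      (of_nat N + a (Suc r)) * (\<Sum>\<sigma>\<in>?P. ?c \<sigma> * v (\<sigma> \<circ> p))"
    by (simp add: comp_def sum_distrib_left[symmetric] distrib_right)
  then show ?case using Suc by (simp add: comp_def)
qed

section \<open>Joins of pairings\<close>

definition constant_on_blocks :: "'a set set \<Rightarrow> ('a \<Rightarrow> 'b) \<Rightarrow> bool" where
  "constant_on_blocks P g \<longleftrightarrow> (\<forall>B\<in>P. \<forall>x\<in>B. \<forall>y\<in>B. g x = g y)"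

lemma card_constant_on_blocks:
  assumes P: "partition_on A P" and A: "finite A"
  shows "card {g \<in> A \<rightarrow>\<^sub>E Y. constant_on_blocks P g} = card Y ^ card P"
proof -
  have finP: "finite P" using finite_elements[OF A P] .
  have un: "\<Union>P = A" and ne: "{} \<notin> P" and disj: "disjoint P" using P by (auto simp: partition_on_def)
  define block where "block x = (THE B. B \<in> P \<and> x \<in> B)" for x
  have block: "block x = B" if "B \<in> P" "x \<in> B" for x B
    unfolding block_def
  proof (rule the_equality)
    fix B' assume B': "B' \<in> P \<and> x \<in> B'"
    show "B' = B"
    proof (rule ccontr)
      assume "B' \<noteq> B"
      then have "B' \<inter> B = {}" using disj B' that(1) by (simp add: disjoint_def)
      then show False using B' that(2) by blast
    qed
  qed (use that in auto)
  define pick where "pick B = (SOME x. x \<in> B)" for B :: "'a set"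
  have pick: "pick B \<in> B" if "B \<in> P" for B
  proof -
    have "B \<noteq> {}" using that ne by metis
    then have "\<exists>x. x \<in> B" by blast
    then show ?thesis unfolding pick_def by (rule someI_ex)
  qed
  have blockP: "block x \<in> P" "x \<in> block x" if "x \<in> A" for x
  proof -
    have "x \<in> \<Union>P" using that un by simp
    then obtain B where "B \<in> P" "x \<in> B" by blast
    then show "block x \<in> P" "x \<in> block x" using block by auto
  qed
  have PA: "x \<in> A" if "B \<in> P" "x \<in> B" for B x using that un by auto
  have "bij_betw (\<lambda>h. \<lambda>x\<in>A. h (block x)) (P \<rightarrow>\<^sub>E Y) {g \<in> A \<rightarrow>\<^sub>E Y. constant_on_blocks P g}"
  proof (rule bij_betw_byWitness[where f' = "\<lambda>g. \<lambda>B\<in>P. g (pick B)"])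
    show "\<forall>h\<in>P \<rightarrow>\<^sub>E Y. (\<lambda>B\<in>P. (\<lambda>x\<in>A. h (block x)) (pick B)) = h"
    proof
      fix h assume h: "h \<in> P \<rightarrow>\<^sub>E Y"
      show "(\<lambda>B\<in>P. (\<lambda>x\<in>A. h (block x)) (pick B)) = h"
      proof
        fix B show "(\<lambda>B\<in>P. (\<lambda>x\<in>A. h (block x)) (pick B)) B = h B"
        proof (cases "B \<in> P")
          case True
          then show ?thesis using pick[OF True] PA[OF True] block[OF True] by simp
        next
          case False
          then show ?thesis using PiE_arb[OF h False] by simp
        qed
      qed
    qed
    show "\<forall>g\<in>{g \<in> A \<rightarrow>\<^sub>E Y. constant_on_blocks P g}. (\<lambda>x\<in>A. (\<lambda>B\<in>P. g (pick B)) (block x)) = g"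
    proof clarify
      fix g assume g: "g \<in> A \<rightarrow>\<^sub>E Y" "constant_on_blocks P g"
      show "(\<lambda>x\<in>A. (\<lambda>B\<in>P. g (pick B)) (block x)) = g"
      proof
        fix x show "(\<lambda>x\<in>A. (\<lambda>B\<in>P. g (pick B)) (block x)) x = g x"
        proof (cases "x \<in> A")
          case True
          have "g (pick (block x)) = g x"
            using g(2) blockP[OF True] pick[OF blockP(1)[OF True]] unfolding constant_on_blocks_def by blast
          then show ?thesis using True blockP[OF True] by simp
        next
          case False
          then show ?thesis using PiE_arb[OF g(1) False] by simp
        qed
      qed
    qed
    show "(\<lambda>h. \<lambda>x\<in>A. h (block x)) ` (P \<rightarrow>\<^sub>E Y) \<subseteq> {g \<in> A \<rightarrow>\<^sub>E Y. constant_on_blocks P g}"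
    proof clarify
      fix h assume h: "h \<in> P \<rightarrow>\<^sub>E Y"
      have "constant_on_blocks P (\<lambda>x\<in>A. h (block x))"
        unfolding constant_on_blocks_def by (auto simp: block PA)
      moreover have "(\<lambda>x\<in>A. h (block x)) \<in> A \<rightarrow>\<^sub>E Y" using h blockP by auto
      ultimately show "(\<lambda>x\<in>A. h (block x)) \<in> A \<rightarrow>\<^sub>E Y \<and> constant_on_blocks P (\<lambda>x\<in>A. h (block x))" by blast
    qed
    show "(\<lambda>g. \<lambda>B\<in>P. g (pick B)) ` {g \<in> A \<rightarrow>\<^sub>E Y. constant_on_blocks P g} \<subseteq> P \<rightarrow>\<^sub>E Y"
    proof (rule image_subsetI)
      fix g assume g: "g \<in> {g \<in> A \<rightarrow>\<^sub>E Y. constant_on_blocks P g}"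
      have "g (pick B) \<in> Y" if "B \<in> P" for B
        using g PA[OF that pick[OF that]] by blast
      then show "(\<lambda>B\<in>P. g (pick B)) \<in> P \<rightarrow>\<^sub>E Y" by simp
    qed
  qed
  then have "card {g \<in> A \<rightarrow>\<^sub>E Y. constant_on_blocks P g} = card (P \<rightarrow>\<^sub>E Y)"
    by (rule bij_betw_same_card[symmetric])
  then show ?thesis by (simp add: card_funcsetE[OF finP])
qed

lemma constant_on_blocks_refines:
  assumes "refines A P Q" "constant_on_blocks Q g"
  shows "constant_on_blocks P g"
  using assms unfolding refines_def constant_on_blocks_def by (meson subsetD)

text \<open>
  A function that is constant on the blocks of \<open>P\<close> and of \<open>Q\<close> has level sets that both
  partitions refine, and so does their join.
\<close>

lemma constant_on_blocks_join:
  assumes P: "partition_on A P" and Q: "partition_on A Q"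
  shows "partition_on A (join (partition_lattice A) P Q)"
    and "constant_on_blocks (join (partition_lattice A) P Q) g \<longleftrightarrow>
      constant_on_blocks P g \<and> constant_on_blocks Q g"
proof -
  interpret lattice "partition_lattice A" by (rule lattice_partition_lattice)
  let ?J = "join (partition_lattice A) P Q"
  have PQ: "P \<in> carrier (partition_lattice A)" "Q \<in> carrier (partition_lattice A)" using P Q by auto
  show J: "partition_on A ?J" using join_closed[OF PQ] by simp
  have PJ: "refines A P ?J" "refines A Q ?J" using join_left[OF PQ] join_right[OF PQ] by auto
  show "constant_on_blocks ?J g \<longleftrightarrow> constant_on_blocks P g \<and> constant_on_blocks Q g"
  proof
    assume "constant_on_blocks ?J g"
    then show "constant_on_blocks P g \<and> constant_on_blocks Q g"
      using PJ constant_on_blocks_refines by metis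
  next
    assume c: "constant_on_blocks P g \<and> constant_on_blocks Q g"
    define K where "K = (\<lambda>x. {y \<in> A. g y = g x}) ` A"
    have K: "partition_on A K" unfolding partition_on_def disjoint_def K_def by auto
    have ref: "refines A R K" if R: "partition_on A R" and cR: "constant_on_blocks R g" for R
      unfolding refines_def
    proof (intro conjI R K ballI)
      fix B assume B: "B \<in> R"
      then have "B \<noteq> {}" using R by (auto simp: partition_on_def)
      then obtain x where x: "x \<in> B" by blast
      have BA: "B \<subseteq> A" using B R by (auto simp: partition_on_def)
      have "B \<subseteq> {y \<in> A. g y = g x}" using cR B x BA unfolding constant_on_blocks_def by blast
      then show "\<exists>Y\<in>K. B \<subseteq> Y" using x BA unfolding K_def by blast
    qed
    have "refines A ?J K"
      using join_le[of P K Q] ref[OF P] ref[OF Q] c P Q K by simp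
    moreover have "constant_on_blocks K g" unfolding constant_on_blocks_def K_def by auto
    ultimately show "constant_on_blocks ?J g" using constant_on_blocks_refines by metis
  qed
qed

definition pairing :: "nat \<Rightarrow> (nat \<Rightarrow> nat) \<Rightarrow> nat set set" where
  "pairing m p = (\<lambda>i. {2 * i - 1, 2 * p i}) ` {1..m}"

lemma odd_eq_double_minus:
  fixes a m :: nat
  assumes "odd a" "a \<in> {1..2 * m}"
  obtains i where "i \<in> {1..m}" "a = 2 * i - 1"
proof -
  have "Suc (a div 2) \<in> {1..m}" "a = 2 * Suc (a div 2) - 1" using assms by (auto elim!: oddE)
  then show thesis by (rule that)
qed

lemma even_eq_double:
  fixes a m :: nat
  assumes "even a" "a \<in> {1..2 * m}"
  obtains i where "i \<in> {1..m}" "a = 2 * i"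
proof -
  have "a div 2 \<in> {1..m}" "a = 2 * (a div 2)" using assms by (auto elim!: evenE)
  then show thesis by (rule that)
qed

lemma odd_double_minus: "i \<in> {1..m} \<Longrightarrow> odd (2 * i - 1 :: nat)"
  by (auto simp: not_less_eq_eq)

lemma double_minus_inj:
  fixes i j :: nat
  assumes "2 * i - 1 = 2 * j - 1" "i \<in> {1..m}" "j \<in> {1..m}"
  shows "i = j"
  using assms unfolding atLeastAtMost_iff by arith

lemma odd_even_pair_eq:
  assumes "odd a" "odd c" "even b" "even (d :: nat)"
  shows "{a, b} = {c, d} \<longleftrightarrow> a = c \<and> b = d"
  using assms by (auto simp: doubleton_eq_iff)

lemma pairing_in_odd_even_pairings:
  assumes p: "p permutes {1..m}"
  shows "pairing m p \<in> odd_even_pairings (2 * m)"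
proof -
  have mem: "p i \<in> {1..m} \<longleftrightarrow> i \<in> {1..m}" for i by (rule permutes_in_image[OF p])
  have "\<Union> (pairing m p) = {1..2 * m}"
  proof (intro subset_antisym subsetI)
    fix a assume "a \<in> \<Union> (pairing m p)"
    then obtain i where i: "i \<in> {1..m}" "a = 2 * i - 1 \<or> a = 2 * p i" by (auto simp: pairing_def)
    have "p i \<in> {1..m}" using mem i by blast
    then show "a \<in> {1..2 * m}" using i by auto
  next
    fix a assume a: "a \<in> {1..2 * m}"
    show "a \<in> \<Union> (pairing m p)"
    proof (cases "even a")
      case True
      then obtain j where j: "j \<in> {1..m}" "a = 2 * j" using a by (rule even_eq_double)
      then obtain i where "i \<in> {1..m}" "p i = j" using permutes_image[OF p] by (metis imageE)
      then show ?thesis using j by (auto simp: pairing_def)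
    next
      case False
      then obtain i where "i \<in> {1..m}" "a = 2 * i - 1" using a by (rule odd_eq_double_minus)
      then show ?thesis by (auto simp: pairing_def)
    qed
  qed
  moreover have "disjoint (pairing m p)"
  proof (rule disjointI)
    fix B C assume "B \<in> pairing m p" "C \<in> pairing m p" "B \<noteq> C"
    then obtain i j where "i \<in> {1..m}" "B = {2 * i - 1, 2 * p i}" "j \<in> {1..m}" "C = {2 * j - 1, 2 * p j}"
      unfolding pairing_def by blast
    with \<open>B \<noteq> C\<close> have ij: "i \<in> {1..m}" "j \<in> {1..m}" "i \<noteq> j" "B = {2 * i - 1, 2 * p i}" "C = {2 * j - 1, 2 * p j}"
      by auto
    have "p i \<noteq> p j" using ij(3) permutes_inj[OF p] by (auto dest: injD)
    moreover have "2 * i - 1 \<noteq> 2 * j - 1" using ij(1-3) double_minus_inj by blast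
    moreover have "2 * i - 1 \<noteq> 2 * p j" "2 * j - 1 \<noteq> 2 * p i"
      using odd_double_minus[OF ij(1)] odd_double_minus[OF ij(2)] by (metis dvd_triv_left)+
    ultimately show "B \<inter> C = {}" using ij(4,5) by auto
  qed
  moreover have "{} \<notin> pairing m p" by (auto simp: pairing_def)
  moreover have "\<exists>a b. B = {a, b} \<and> odd a \<and> even b" if B: "B \<in> pairing m p" for B
  proof -
    obtain i where "i \<in> {1..m}" "B = {2 * i - 1, 2 * p i}" using B unfolding pairing_def by blast
    then show ?thesis using odd_double_minus by (metis dvd_triv_left)
  qed
  ultimately show ?thesis by (simp add: odd_even_pairings_def partition_on_def)
qed

lemma bij_betw_pairing: "bij_betw (pairing m) {p. p permutes {1..m}} (odd_even_pairings (2 * m))"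
  unfolding bij_betw_def
proof
  show "inj_on (pairing m) {p. p permutes {1..m}}"
  proof (rule inj_onI, clarify)
    fix p q assume p: "p permutes {1..m}" and q: "q permutes {1..m}" and e: "pairing m p = pairing m q"
    have "p i = q i" for i
    proof (cases "i \<in> {1..m}")
      case True
      then have "{2 * i - 1, 2 * p i} \<in> pairing m p" unfolding pairing_def by (rule imageI)
      then have "{2 * i - 1, 2 * p i} \<in> pairing m q" unfolding e .
      then obtain j where j: "j \<in> {1..m}" "{2 * i - 1, 2 * p i} = {2 * j - 1, 2 * q j}"
        by (auto simp: pairing_def)
      then have "2 * i - 1 = 2 * j - 1 \<and> 2 * p i = 2 * q j"
        using odd_even_pair_eq[OF odd_double_minus[OF True] odd_double_minus[OF j(1)]] by simp
      then show ?thesis using double_minus_inj[OF _ True j(1)] by simp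
    next
      case False
      then show ?thesis using p q by (simp add: permutes_not_in)
    qed
    then show "p = q" by auto
  qed
  show "pairing m ` {p. p permutes {1..m}} = odd_even_pairings (2 * m)"
  proof (intro subset_antisym subsetI)
    fix P assume P: "P \<in> odd_even_pairings (2 * m)"
    then have un: "\<Union>P = {1..2 * m}" and disj: "\<And>B C. B \<in> P \<Longrightarrow> C \<in> P \<Longrightarrow> B \<inter> C \<noteq> {} \<Longrightarrow> B = C"
      and blk: "\<And>B. B \<in> P \<Longrightarrow> \<exists>a b. B = {a, b} \<and> odd a \<and> even b"
      by (auto simp: odd_even_pairings_def partition_on_def disjoint_def)
    have ex: "\<exists>j\<in>{1..m}. {2 * i - 1, 2 * j} \<in> P" if i: "i \<in> {1..m}" for i
    proof -
      have "2 * i - 1 \<in> \<Union>P" using i un by auto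
      then obtain B where B: "B \<in> P" "2 * i - 1 \<in> B" by auto
      obtain a b where ab: "B = {a, b}" "odd a" "even b" using blk[OF B(1)] by auto
      have "a = 2 * i - 1" using B(2) ab odd_double_minus[OF i] by auto
      moreover have "b \<in> {1..2 * m}" using un B(1) ab(1) by blast
      then obtain j where "j \<in> {1..m}" "b = 2 * j" using ab(3) even_eq_double by metis
      ultimately show ?thesis using B ab by auto
    qed
    then obtain f where f: "\<And>i. i \<in> {1..m} \<Longrightarrow> f i \<in> {1..m} \<and> {2 * i - 1, 2 * f i} \<in> P" by metis
    define p where "p i = (if i \<in> {1..m} then f i else i)" for i
    have p: "p i \<in> {1..m}" "{2 * i - 1, 2 * p i} \<in> P" if "i \<in> {1..m}" for i
      using f[OF that] that by (simp_all add: p_def)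
    have "inj_on p {1..m}"
    proof (rule inj_onI)
      fix i j assume ij: "i \<in> {1..m}" "j \<in> {1..m}" "p i = p j"
      have "{2 * i - 1, 2 * p i} = {2 * j - 1, 2 * p j}"
        by (rule disj[OF p(2)[OF ij(1)] p(2)[OF ij(2)]]) (use ij(3) in auto)
      then have "2 * i - 1 = 2 * j - 1"
        using odd_even_pair_eq[OF odd_double_minus[OF ij(1)] odd_double_minus[OF ij(2)]] by simp
      then show "i = j" by (rule double_minus_inj[OF _ ij(1,2)])
    qed
    moreover have "p ` {1..m} \<subseteq> {1..m}" using p(1) by blast
    ultimately have "bij_betw p {1..m} {1..m}"
      by (simp add: bij_betw_def endo_inj_surj)
    then have pp: "p permutes {1..m}" by (rule bij_imp_permutes) (auto simp: p_def)
    have sub: "pairing m p \<subseteq> P" using p(2) by (auto simp: pairing_def)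
    have "P \<subseteq> pairing m p"
    proof
      fix B assume B: "B \<in> P"
      obtain a b where ab: "B = {a, b}" "odd a" "even b" using blk[OF B] by auto
      have "a \<in> {1..2 * m}" using B ab un by auto
      with ab(2) obtain i where i: "i \<in> {1..m}" "a = 2 * i - 1" by (rule odd_eq_double_minus)
      have "B = {2 * i - 1, 2 * p i}"
        by (rule disj[OF B p(2)[OF i(1)]]) (use ab i in auto)
      then show "B \<in> pairing m p" using i by (auto simp: pairing_def)
    qed
    then show "P \<in> pairing m ` {p. p permutes {1..m}}" using sub pp by blast
  qed (use pairing_in_odd_even_pairings in auto)
qed

text \<open>
  A colouring that is constant on the blocks of both pairings is determined by the colours
  \<open>h j\<close> of the even numbers \<open>2 j\<close>. The odd number \<open>2 i - 1\<close> forces \<open>h (p i) = h (q i)\<close>,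
  which says that \<open>h\<close> is fixed by \<open>q \<circ> p\<inverse>\<close>.
\<close>

lemma card_join_pairings:
  assumes p: "p permutes {1..m}" and q: "q permutes {1..m}"
  shows "N ^ card (join (partition_lattice {1..2 * m}) (pairing m p) (pairing m q)) =
    card (fixed_colourings m N (q \<circ> pinv p))"
proof -
  let ?A = "{1..2 * m}" and ?J = "join (partition_lattice {1..2 * m}) (pairing m p) (pairing m q)"
  have part: "partition_on ?A (pairing m p)" "partition_on ?A (pairing m q)"
    using pairing_in_odd_even_pairings[OF p] pairing_in_odd_even_pairings[OF q]
    by (auto simp: odd_even_pairings_def)
  have const: "constant_on_blocks (pairing m r) g \<longleftrightarrow> (\<forall>i\<in>{1..m}. g (2 * i - 1) = g (2 * r i))" for r and g :: "nat \<Rightarrow> nat"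
    by (auto simp: constant_on_blocks_def pairing_def)
  have mem: "p i \<in> {1..m} \<longleftrightarrow> i \<in> {1..m}" "q i \<in> {1..m} \<longleftrightarrow> i \<in> {1..m}"
      "pinv p i \<in> {1..m} \<longleftrightarrow> i \<in> {1..m}" for i
    using permutes_in_image[OF p] permutes_in_image[OF q] permutes_in_image[OF permutes_inv[OF p]] by blast+
  have pi: "p (pinv p i) = i" "pinv p (p i) = i" for i by (rule permutes_inverses[OF p])+
  let ?G = "{g \<in> ?A \<rightarrow>\<^sub>E {..<N}. constant_on_blocks ?J g}"
  have G: "g \<in> ?G \<longleftrightarrow> g \<in> ?A \<rightarrow>\<^sub>E {..<N} \<and> (\<forall>i\<in>{1..m}. g (2 * i - 1) = g (2 * p i) \<and> g (2 * i - 1) = g (2 * q i))" for g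
    unfolding mem_Collect_eq constant_on_blocks_join(2)[OF part] const by blast
  have "bij_betw (\<lambda>g. \<lambda>j\<in>{1..m}. g (2 * j)) ?G (fixed_colourings m N (q \<circ> pinv p))"
  proof (rule bij_betw_imageI)
    show "inj_on (\<lambda>g. \<lambda>j\<in>{1..m}. g (2 * j)) ?G"
    proof (rule inj_onI)
      fix g h assume g: "g \<in> ?G" and h: "h \<in> ?G"
        and e: "(\<lambda>j\<in>{1..m}. g (2 * j)) = (\<lambda>j\<in>{1..m}. h (2 * j))"
      have ev: "g (2 * j) = h (2 * j)" if "j \<in> {1..m}" for j using fun_cong[OF e, of j] that by simp
      show "g = h"
      proof (rule PiE_ext[of g ?A "\<lambda>_. {..<N}" h])
        fix a assume a: "a \<in> ?A"
        show "g a = h a"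
        proof (cases "even a")
          case True
          then obtain j where "j \<in> {1..m}" "a = 2 * j" using a by (rule even_eq_double)
          then show ?thesis using ev by simp
        next
          case False
          then obtain i where i: "i \<in> {1..m}" "a = 2 * i - 1" using a by (rule odd_eq_double_minus)
          have "g a = g (2 * p i)" "h a = h (2 * p i)" using g h i unfolding G by blast+
          then show ?thesis using ev[of "p i"] mem(1)[of i] i(1) by metis
        qed
      qed (use g h in auto)
    qed
    show "(\<lambda>g. \<lambda>j\<in>{1..m}. g (2 * j)) ` ?G = fixed_colourings m N (q \<circ> pinv p)"
    proof (intro subset_antisym subsetI)
      fix h assume "h \<in> (\<lambda>g. \<lambda>j\<in>{1..m}. g (2 * j)) ` ?G"
      then obtain g where g: "g \<in> ?G" and h: "h = (\<lambda>j\<in>{1..m}. g (2 * j))" by blast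
      have "h (q (pinv p j)) = h j" if "j \<in> {1..m}" for j
      proof -
        have j': "pinv p j \<in> {1..m}" "q (pinv p j) \<in> {1..m}" using mem that by blast+
        then have "g (2 * p (pinv p j)) = g (2 * q (pinv p j))" using g unfolding G by metis
        then show ?thesis using j' that by (simp add: h pi)
      qed
      moreover have "h \<in> {1..m} \<rightarrow>\<^sub>E {..<N}"
      proof -
        have "g (2 * j) \<in> {..<N}" if "j \<in> {1..m}" for j
          using g that by (intro PiE_mem[of g ?A]) auto
        then show ?thesis by (auto simp: h)
      qed
      ultimately show "h \<in> fixed_colourings m N (q \<circ> pinv p)" by (simp add: fixed_colourings_def)
    next
      fix h assume h: "h \<in> fixed_colourings m N (q \<circ> pinv p)"
      define g where "g = (\<lambda>a\<in>?A. if even a then h (a div 2) else h (p (Suc (a div 2))))"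
      have ge: "g (2 * j) = h j" if "j \<in> {1..m}" for j using that by (auto simp: g_def)
      have go: "g (2 * i - 1) = h (p i)" if i: "i \<in> {1..m}" for i
      proof -
        have "odd (2 * i - 1)" by (rule odd_double_minus[OF i])
        moreover have "2 * i - 1 \<in> ?A" "Suc ((2 * i - 1) div 2) = i" using i by auto
        ultimately show ?thesis by (simp add: g_def)
      qed
      have hr: "h j \<in> {..<N}" if "j \<in> {1..m}" for j
        using h that unfolding fixed_colourings_def by blast
      have "g \<in> ?A \<rightarrow>\<^sub>E {..<N}"
      proof (rule PiE_I)
        fix a assume a: "a \<in> ?A"
        show "g a \<in> {..<N}"
        proof (cases "even a")
          case True
          then obtain j where "j \<in> {1..m}" "a = 2 * j" using a by (rule even_eq_double)
          then show ?thesis using ge hr by simp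
        next
          case False
          then obtain i where i: "i \<in> {1..m}" "a = 2 * i - 1" using a by (rule odd_eq_double_minus)
          then show ?thesis using go[OF i(1)] hr[of "p i"] mem(1)[of i] by metis
        qed
      qed (auto simp: g_def restrict_def)
      moreover have "g (2 * i - 1) = g (2 * p i) \<and> g (2 * i - 1) = g (2 * q i)" if i: "i \<in> {1..m}" for i
      proof -
        have pq: "p i \<in> {1..m}" "q i \<in> {1..m}" using mem i by blast+
        have "h (q (pinv p (p i))) = h (p i)" using h pq(1) unfolding fixed_colourings_def by simp
        then show ?thesis using go[OF i] ge[OF pq(1)] ge[OF pq(2)] by (simp add: pi)
      qed
      ultimately have "g \<in> ?G" unfolding G by blast
      moreover have "h = (\<lambda>j\<in>{1..m}. g (2 * j))"
      proof
        fix j show "h j = (\<lambda>j\<in>{1..m}. g (2 * j)) j"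
        proof (cases "j \<in> {1..m}")
          case True
          then show ?thesis using ge[OF True] by simp
        next
          case False
          have "h \<in> {1..m} \<rightarrow>\<^sub>E {..<N}" using h by (simp add: fixed_colourings_def)
          then have "h j = undefined" using False by (rule PiE_arb)
          then show ?thesis using False by (simp only: restrict_apply if_False)
        qed
      qed
      ultimately show "h \<in> (\<lambda>g. \<lambda>j\<in>{1..m}. g (2 * j)) ` ?G" by blast
    qed
  qed
  then have "card ?G = card (fixed_colourings m N (q \<circ> pinv p))" by (rule bij_betw_same_card)
  moreover have "card ?G = N ^ card ?J"
    using card_constant_on_blocks[OF constant_on_blocks_join(1)[OF part], of "{..<N}"] by simp
  ultimately show ?thesis by simp
qed

lemma odd_even_pairings_odd:
  assumes "odd k"
  shows "odd_even_pairings k = {}"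
proof -
  have False if P: "P \<in> odd_even_pairings k" for P
  proof -
    have part: "partition_on {1..k} P" and blk: "\<And>B. B \<in> P \<Longrightarrow> \<exists>a b. B = {a, b} \<and> odd a \<and> even b"
      using P by (auto simp: odd_even_pairings_def)
    have "2 * card P = card (\<Union>P)"
    proof (rule card_partition)
      show "finite P" using finite_elements[OF _ part] by simp
      show "finite (\<Union>P)" using part by (simp add: partition_on_def)
      show "card B = 2" if B: "B \<in> P" for B
      proof -
        obtain a b where "B = {a, b}" "odd a" "even b" using blk[OF B] by blast
        then show ?thesis by (cases "a = b") auto
      qed
      show "B \<inter> C = {}" if "B \<in> P" "C \<in> P" "B \<noteq> C" for B C
        using part that by (auto simp: partition_on_def disjoint_def)
    qed
    also have "\<dots> = k" using part by (simp add: partition_on_def)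
    finally show False using assms by (metis dvd_triv_left)
  qed
  then show ?thesis by blast
qed

section \<open>The basis of common eigenvectors and the determinant\<close>

text \<open>
  The assumption \<open>closed\<close> is what remains of an operator \<open>t\<close> with eigenvalues \<open>e t x\<close>: it
  can be applied to a linear relation. Subtracting a multiple of the original relation then
  makes the support smaller, so a relation of minimal support involves a single vector.
\<close>

lemma joint_eigenvectors_independent:
  fixes v :: "'x \<Rightarrow> 'p \<Rightarrow> 'f::field" and e :: "'t \<Rightarrow> 'x \<Rightarrow> 'f"
  assumes fin: "finite X"
    and closed: "\<And>t w. t \<in> Ops \<Longrightarrow> \<forall>p\<in>Q. (\<Sum>x\<in>X. w x * v x p) = 0 \<Longrightarrow>
      \<forall>p\<in>Q. (\<Sum>x\<in>X. w x * (e t x * v x p)) = 0"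
    and sep: "\<And>x y. x \<in> X \<Longrightarrow> y \<in> X \<Longrightarrow> x \<noteq> y \<Longrightarrow> \<exists>t\<in>Ops. e t x \<noteq> e t y"
    and nz: "\<And>x. x \<in> X \<Longrightarrow> \<exists>p\<in>Q. v x p \<noteq> 0"
    and rel: "\<forall>p\<in>Q. (\<Sum>x\<in>X. w x * v x p) = 0"
  shows "\<forall>x\<in>X. w x = 0"
  using rel
proof (induction "card {x \<in> X. w x \<noteq> 0}" arbitrary: w rule: less_induct)
  case less
  show ?case
  proof (rule ccontr)
    assume "\<not> ?thesis"
    then obtain x where x: "x \<in> X" "w x \<noteq> 0" by blast
    show False
    proof (cases "\<exists>y\<in>X. y \<noteq> x \<and> w y \<noteq> 0")
      case True
      then obtain y where y: "y \<in> X" "y \<noteq> x" "w y \<noteq> 0" by blast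
      obtain t where t: "t \<in> Ops" "e t x \<noteq> e t y" using sep[OF x(1) y(1)] y(2) by blast
      define w' where "w' z = w z * (e t z - e t x)" for z
      have "(\<Sum>z\<in>X. w' z * v z p) = (\<Sum>z\<in>X. w z * (e t z * v z p)) - e t x * (\<Sum>z\<in>X. w z * v z p)" for p
        by (simp add: w'_def sum_subtractf[symmetric] sum_distrib_left algebra_simps)
      then have rel': "\<forall>p\<in>Q. (\<Sum>z\<in>X. w' z * v z p) = 0"
        using closed[OF t(1) less.prems] less.prems by simp
      have "{z \<in> X. w' z \<noteq> 0} \<subset> {z \<in> X. w z \<noteq> 0}"
        using x by (auto simp: w'_def)
      then have "card {z \<in> X. w' z \<noteq> 0} < card {z \<in> X. w z \<noteq> 0}"
        using fin by (intro psubset_card_mono) auto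
      then have "w' y = 0" using less.hyps rel' y(1) by blast
      then show False using y t by (simp add: w'_def)
    next
      case False
      obtain p where p: "p \<in> Q" "v x p \<noteq> 0" using nz[OF x(1)] by blast
      have "(\<Sum>z\<in>X. w z * v z p) = w x * v x p"
        using False x fin by (subst sum.remove[of _ x]) (auto intro!: sum.neutral)
      then show False using less.prems p x by auto
    qed
  qed
qed

definition tableau_pairs :: "nat \<Rightarrow>
    ((nat \<times> nat) set \<times> (nat \<times> nat \<Rightarrow> nat) \<times> (nat \<times> nat \<Rightarrow> nat)) set" where
  "tableau_pairs m = (SIGMA \<mu>:young_diagrams m. SYT \<mu> \<times> SYT \<mu>)"

lemma card_tableau_pairs: "finite (tableau_pairs m)" "card (tableau_pairs m) = fact m"
proof -
  have fin: "finite (SYT \<mu>)" if "\<mu> \<in> young_diagrams m" for \<mu>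
    using that by (auto simp: young_diagrams_def intro: finite_SYT)
  then show "finite (tableau_pairs m)"
    unfolding tableau_pairs_def by (intro finite_SigmaI finite_young_diagrams_of_size finite_cartesian_product)
  have "card (tableau_pairs m) = (\<Sum>\<mu>\<in>young_diagrams m. card (SYT \<mu> \<times> SYT \<mu>))"
    unfolding tableau_pairs_def
    by (rule card_SigmaI) (use fin finite_young_diagrams_of_size in auto)
  also have "\<dots> = fact m"
    using sum_squares_num_SYT[of m] by (simp add: card_cartesian_product power2_eq_square)
  finally show "card (tableau_pairs m) = fact m" .
qed

definition weight :: "(nat \<times> nat) set \<Rightarrow> (nat \<times> nat \<Rightarrow> nat) \<Rightarrow> nat \<Rightarrow> rat" where
  "weight \<mu> T l = of_int (box_content (inv_into \<mu> T l))"

lemma has_weightD: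
  assumes T: "T \<in> SYT \<mu>" and v: "has_weight \<mu> T v" and l: "l \<in> {1..card \<mu>}" and p: "p permutes {1..card \<mu>}"
  shows "jucys_murphy l v p = weight \<mu> T l * v p"
proof -
  have "l \<in> T ` \<mu>" using SYT_bij[OF T] l by (simp add: bij_betw_def)
  then have "inv_into \<mu> T l \<in> \<mu>" "T (inv_into \<mu> T l) = l" by (simp_all add: inv_into_into f_inv_into_f)
  then show ?thesis using v p unfolding has_weight_def weight_def by metis
qed

lemma weight_separates:
  assumes "\<mu> \<in> young_diagrams m" "\<nu> \<in> young_diagrams m" "S \<in> SYT \<mu>" "T \<in> SYT \<nu>" "(\<mu>, S) \<noteq> (\<nu>, T)"
  shows "\<exists>l\<in>{1..m}. weight \<mu> S l \<noteq> weight \<nu> T l"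
proof (rule ccontr)
  assume eq: "\<not> ?thesis"
  have Y: "young_diagram \<mu>" "young_diagram \<nu>" "card \<mu> = m" "card \<nu> = m"
    using assms by (auto simp: young_diagrams_def)
  have "box_content x = box_content y" if xy: "x \<in> \<mu>" "y \<in> \<nu>" "S x = T y" for x y
  proof -
    have "S x \<in> {1..m}" using SYT_range[OF assms(3) xy(1)] Y by simp
    then have "weight \<mu> S (S x) = weight \<nu> T (T y)" using eq xy(3) by auto
    moreover have "inv_into \<mu> S (S x) = x" "inv_into \<nu> T (T y) = y"
      using bij_betw_inv_into_left[OF SYT_bij[OF assms(3)] xy(1)]
        bij_betw_inv_into_left[OF SYT_bij[OF assms(4)] xy(2)] .
    ultimately show ?thesis by (simp add: weight_def)
  qed
  then have "\<mu> = \<nu> \<and> S = T"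
    using SYT_determined_by_contents[OF Y(1,2) _ assms(3,4)] Y(3,4) by simp
  then show False using assms(5) by simp
qed

lemma prod_weight:
  assumes "T \<in> SYT \<mu>"
  shows "(\<Prod>l\<in>{1..card \<mu>}. of_nat N + weight \<mu> T l) = content_product (of_nat N) \<mu>"
proof -
  have bij: "bij_betw T \<mu> {1..card \<mu>}" by (rule SYT_bij[OF assms])
  have "(\<Prod>l\<in>{1..card \<mu>}. of_nat N + weight \<mu> T l) = (\<Prod>x\<in>\<mu>. of_nat N + weight \<mu> T (T x))"
    by (rule prod.reindex_bij_betw[OF bij, symmetric])
  also have "\<dots> = content_product (of_nat N) \<mu>"
    unfolding content_product_def
    by (rule prod.cong) (use bij in \<open>auto simp: weight_def box_content_def bij_betw_def inv_into_f_f\<close>)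
  finally show ?thesis .
qed

definition weight_vector ::
    "(nat \<times> nat) set \<times> (nat \<times> nat \<Rightarrow> nat) \<times> (nat \<times> nat \<Rightarrow> nat) \<Rightarrow> (nat \<Rightarrow> nat) \<Rightarrow> rat" where
  "weight_vector = (\<lambda>(\<mu>, S, T). SOME v. bi_weight_vector \<mu> S T v)"

lemma tableau_pairsD:
  assumes "(\<mu>, S, T) \<in> tableau_pairs m"
  shows "\<mu> \<in> young_diagrams m" "young_diagram \<mu>" "card \<mu> = m" "S \<in> SYT \<mu>" "T \<in> SYT \<mu>"
  using assms by (auto simp: tableau_pairs_def young_diagrams_def)

lemma weight_vector:
  assumes "(\<mu>, S, T) \<in> tableau_pairs m"
  shows "has_weight \<mu> S (weight_vector (\<mu>, S, T))"
    and "has_weight \<mu> T (\<lambda>p. weight_vector (\<mu>, S, T) (pinv p))"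
    and "\<exists>p\<in>{p. p permutes {1..m}}. weight_vector (\<mu>, S, T) p \<noteq> 0"
proof -
  note m = tableau_pairsD[OF assms]
  have "bi_weight_vector \<mu> S T (weight_vector (\<mu>, S, T))"
    unfolding weight_vector_def prod.case by (rule someI_ex[OF bi_weight_vector_exists[OF m(2,4,5)]])
  then show "has_weight \<mu> S (weight_vector (\<mu>, S, T))"
    "has_weight \<mu> T (\<lambda>p. weight_vector (\<mu>, S, T) (pinv p))"
    "\<exists>p\<in>{p. p permutes {1..m}}. weight_vector (\<mu>, S, T) p \<noteq> 0"
    using m(3) by (auto simp: bi_weight_vector_def)
qed

text \<open>
  The joint eigenvalues on the two sides tell any two pairs of tableaux apart.
\<close>

lemma weight_vectors_independent:
  assumes rel: "\<forall>p\<in>{p. p permutes {1..m}}. (\<Sum>z\<in>tableau_pairs m. w z * weight_vector z p) = 0"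
  shows "\<forall>z\<in>tableau_pairs m. w z = 0"
proof -
  let ?perms = "{p. p permutes {1..m}}" and ?X = "tableau_pairs m" and ?V = weight_vector
  note finX = card_tableau_pairs(1)[of m]
  have perm: "transpose j l \<circ> p permutes {1..m}"
    if "p permutes {1..m}" "l \<in> {1..m}" "j \<in> {1..<l}" for j l p
    using that by (intro permutes_transpose_comp) auto
  \<comment> \<open>\<open>(True, l)\<close> stands for \<open>J\<^sub>l\<close> acting from the left, \<open>(False, l)\<close> for its action from the right.\<close>
  define e where "e = (\<lambda>(b, l) (\<mu>, S, T). weight \<mu> (if b then S else T) l)"
  show ?thesis
  proof (rule joint_eigenvectors_independent[where Ops = "UNIV \<times> {1..m}" and e = e, OF finX _ _ _ rel])
    show "\<exists>p\<in>?perms. ?V z p \<noteq> 0" if "z \<in> ?X" for z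
      using that weight_vector(3)[of _ _ _ m] by (cases z) auto
    show "\<exists>bl\<in>UNIV \<times> {1..m}. e bl z \<noteq> e bl z'" if z: "z \<in> ?X" "z' \<in> ?X" "z \<noteq> z'" for z z'
    proof -
      obtain \<mu> S T \<mu>' S' T' where zz: "z = (\<mu>, S, T)" "z' = (\<mu>', S', T')" by (cases z; cases z') auto
      note m1 = tableau_pairsD[OF z(1)[unfolded zz]] and m2 = tableau_pairsD[OF z(2)[unfolded zz]]
      consider "(\<mu>, S) \<noteq> (\<mu>', S')" | "(\<mu>, T) \<noteq> (\<mu>', T')" using z(3) zz by auto
      then show ?thesis
      proof cases
        case 1
        then obtain l where "l \<in> {1..m}" "weight \<mu> S l \<noteq> weight \<mu>' S' l"
          using weight_separates[OF m1(1) m2(1) m1(4) m2(4)] by blast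
        then show ?thesis by (intro bexI[of _ "(True, l)"]) (simp_all add: e_def zz)
      next
        case 2
        then obtain l where "l \<in> {1..m}" "weight \<mu> T l \<noteq> weight \<mu>' T' l"
          using weight_separates[OF m1(1) m2(1) m1(5) m2(5)] by blast
        then show ?thesis by (intro bexI[of _ "(False, l)"]) (simp_all add: e_def zz)
      qed
    qed
    show "\<forall>p\<in>?perms. (\<Sum>z\<in>?X. w z * (e bl z * ?V z p)) = 0"
      if bl: "bl \<in> UNIV \<times> {1..m}" and rel: "\<forall>p\<in>?perms. (\<Sum>z\<in>?X. w z * ?V z p) = 0" for bl w
    proof
      fix p assume "p \<in> ?perms"
      then have p: "p permutes {1..m}" by simp
      obtain b l where blq: "bl = (b, l)" "l \<in> {1..m}" using bl by auto
      show "(\<Sum>z\<in>?X. w z * (e bl z * ?V z p)) = 0"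
      proof (cases b)
        case True
        have "e bl z * ?V z p = jucys_murphy l (?V z) p" if z: "z \<in> ?X" for z
        proof -
          obtain \<mu> S T where zz: "z = (\<mu>, S, T)" by (cases z) auto
          note zX = z[unfolded zz]
          show ?thesis
            using has_weightD[OF tableau_pairsD(4)[OF zX] weight_vector(1)[OF zX], of l p] tableau_pairsD(3)[OF zX] blq p True
            by (simp add: e_def zz)
        qed
        then have "(\<Sum>z\<in>?X. w z * (e bl z * ?V z p)) =
            (\<Sum>z\<in>?X. \<Sum>j\<in>{1..<l}. w z * ?V z (transpose j l \<circ> p))"
          by (intro sum.cong refl) (simp only: jucys_murphy_def sum_distrib_left)
        also have "\<dots> = (\<Sum>j\<in>{1..<l}. \<Sum>z\<in>?X. w z * ?V z (transpose j l \<circ> p))"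
          by (rule sum.swap)
        also have "\<dots> = 0"
        proof (rule sum.neutral, rule ballI)
          fix j assume "j \<in> {1..<l}"
          from perm[OF p blq(2) this] rel
          show "(\<Sum>z\<in>?X. w z * ?V z (transpose j l \<circ> p)) = 0" by blast
        qed
        finally show ?thesis .
      next
        case False
        have p': "pinv p permutes {1..m}" by (rule permutes_inv[OF p])
        have "e bl z * ?V z p = jucys_murphy l (\<lambda>p. ?V z (pinv p)) (pinv p)" if z: "z \<in> ?X" for z
        proof -
          obtain \<mu> S T where zz: "z = (\<mu>, S, T)" by (cases z) auto
          note zX = z[unfolded zz]
          show ?thesis
            using has_weightD[OF tableau_pairsD(5)[OF zX] weight_vector(2)[OF zX], of l "pinv p"] tableau_pairsD(3)[OF zX] blq p p' False
            by (simp add: e_def zz permutes_inv_inv[OF p])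
        qed
        then have "(\<Sum>z\<in>?X. w z * (e bl z * ?V z p)) =
            (\<Sum>z\<in>?X. \<Sum>j\<in>{1..<l}. w z * ?V z (pinv (transpose j l \<circ> pinv p)))"
          by (intro sum.cong refl) (simp only: jucys_murphy_def sum_distrib_left)
        also have "\<dots> = (\<Sum>j\<in>{1..<l}. \<Sum>z\<in>?X. w z * ?V z (pinv (transpose j l \<circ> pinv p)))"
          by (rule sum.swap)
        also have "\<dots> = 0"
        proof (rule sum.neutral, rule ballI)
          fix j assume "j \<in> {1..<l}"
          from permutes_inv[OF perm[OF p' blq(2) this]] rel
          show "(\<Sum>z\<in>?X. w z * ?V z (pinv (transpose j l \<circ> pinv p))) = 0" by blast
        qed
        finally show ?thesis .
      qed
    qed
  qed
qed

text \<open>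
  Row \<open>p\<close> of the Gram matrix pairs a vector \<open>v\<close> with the numbers of colourings fixed by
  \<open>\<sigma> = r \<circ> p\<inverse>\<close>, so the matrix acts as the product of the operators \<open>N + J\<^sub>l\<close>.
\<close>

lemma gram_weight_vector:
  assumes z: "z \<in> tableau_pairs m" and p: "p permutes {1..m}"
  shows "(\<Sum>r | r permutes {1..m}. of_nat N ^ card (join (partition_lattice {1..2 * m}) (pairing m p) (pairing m r)) *
      weight_vector z r) = content_product (of_nat N) (fst z) * weight_vector z p"
proof -
  obtain \<mu> S T where zeq: "z = (\<mu>, S, T)" by (cases z) auto
  note zX = z[unfolded zeq]
  have "(\<Sum>r\<in>{p. p permutes {1..m}}. of_nat N ^ card (join (partition_lattice {1..2 * m}) (pairing m p) (pairing m r)) * weight_vector z r) =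
      (\<Sum>r\<in>{p. p permutes {1..m}}. of_nat (card (fixed_colourings m N (r \<circ> pinv p))) * weight_vector z r)"
    by (rule sum.cong[OF refl])
      (simp add: card_join_pairings[OF p, symmetric])
  also have "\<dots> = (\<Sum>\<sigma>\<in>{p. p permutes {1..m}}. of_nat (card (fixed_colourings m N ((\<sigma> \<circ> p) \<circ> pinv p))) * weight_vector z (\<sigma> \<circ> p))"
    by (rule sum_permutations_compose_right[OF p])
  also have "\<dots> = (\<Sum>\<sigma>\<in>{p. p permutes {1..m}}. of_nat (card (fixed_colourings m N \<sigma>)) * weight_vector z (\<sigma> \<circ> p))"
    by (simp only: comp_assoc permutes_inv_o(1)[OF p] comp_id)
  also have "\<dots> = (\<Prod>l\<in>{1..m}. of_nat N + weight \<mu> S l) * weight_vector z p"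
    by (rule sum_fixed_colourings_eigenvector[OF _ order_refl p])
      (use has_weightD[OF tableau_pairsD(4)[OF zX] weight_vector(1)[OF zX]] tableau_pairsD(3)[OF zX] in \<open>simp add: zeq\<close>)
  also have "\<dots> = content_product (of_nat N) (fst z) * weight_vector z p"
    using prod_weight[OF tableau_pairsD(4)[OF zX], of N] tableau_pairsD(3)[OF zX] by (simp add: zeq)
  finally show ?thesis .
qed

text \<open>
  The matrix \<open>P\<close> with the eigenvectors as columns is square because there are as many pairs of
  tableaux as permutations, and invertible because the eigenvectors are independent. It
  diagonalizes the Gram matrix.
\<close>

lemma det_gram_of_nat:
  assumes ps: "distinct ps" "set ps = odd_even_pairings (2 * m)"
  shows "det (half_liberated_gram (2 * m) (of_nat N :: rat) ps) =
    (\<Prod>\<mu>\<in>young_diagrams m. content_product (of_nat N) \<mu> ^ (num_standard_tableaux \<mu>)\<^sup>2)"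
proof -
  define d :: nat where "d = fact m"
  let ?perms = "{p. p permutes {1..m}}"
  let ?X = "tableau_pairs m"
  note finX = card_tableau_pairs(1)[of m]
  have card_perms: "card ?perms = d" unfolding d_def by (rule card_permutations) simp_all
  have len: "length ps = d"
    using ps distinct_card[of ps] bij_betw_same_card[OF bij_betw_pairing[of m]] card_perms by simp
  define q where "q i = inv_into ?perms (pairing m) (ps ! i)" for i
  have q: "q i permutes {1..m}" "pairing m (q i) = ps ! i" if "i < d" for i
  proof -
    have "ps ! i \<in> set ps" using that len by simp
    then have i: "ps ! i \<in> pairing m ` ?perms"
      unfolding ps(2) bij_betw_imp_surj_on[OF bij_betw_pairing] .
    show "q i permutes {1..m}" using inv_into_into[OF i] unfolding q_def by blast
    show "pairing m (q i) = ps ! i" unfolding q_def by (rule f_inv_into_f[OF i])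
  qed
  have bij_q: "bij_betw q {..<d} ?perms"
  proof (rule bij_betw_imageI)
    show inj: "inj_on q {..<d}"
    proof (rule inj_onI)
      fix i j assume "i \<in> {..<d}" "j \<in> {..<d}" and qq: "q i = q j"
      then have ij: "i < d" "j < d" by simp_all
      have "ps ! i = ps ! j" using q(2)[OF ij(1)] q(2)[OF ij(2)] by (simp only: qq)
      then show "i = j" using nth_eq_iff_index_eq[OF ps(1)] ij by (simp only: len)
    qed
    have "q ` {..<d} \<subseteq> ?perms" using q(1) by auto
    then show "q ` {..<d} = ?perms"
      by (rule card_subset_eq[OF finite_permutations[OF finite_atLeastAtMost]])
        (simp only: card_image[OF inj] card_perms card_lessThan)
  qed
  obtain x where bij_x: "bij_betw x {..<d} ?X"
    using ex_bij_betw_nat_finite[OF finX] card_tableau_pairs(2)[of m] by (auto simp: d_def atLeast0LessThan)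
  have xX: "x j \<in> ?X" if "j < d" for j using bij_x that by (auto dest: bij_betwE)
  define G where "G = half_liberated_gram (2 * m) (of_nat N :: rat) ps"
  define P where "P = mat d d (\<lambda>(i, j). weight_vector (x j) (q i))"
  define ev where "ev = (\<lambda>z :: (nat \<times> nat) set \<times> (nat \<times> nat \<Rightarrow> nat) \<times> (nat \<times> nat \<Rightarrow> nat).
    content_product (of_nat N :: rat) (fst z))"
  have G: "G \<in> carrier_mat d d" and P: "P \<in> carrier_mat d d"
    by (simp_all add: G_def half_liberated_gram_def len P_def)

  have "G * P = P * mat_diag d (\<lambda>j. ev (x j))"
  proof (rule eq_matI)
    fix i j assume "i < dim_row (P * mat_diag d (\<lambda>j. ev (x j)))" "j < dim_col (P * mat_diag d (\<lambda>j. ev (x j)))"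
    then have ij: "i < d" "j < d" using P by (simp_all add: mat_diag_def)
    have "(G * P) $$ (i, j) = (\<Sum>l\<in>{..<d}. G $$ (i, l) * P $$ (l, j))"
      using G P ij by (simp add: scalar_prod_def atLeast0LessThan)
    also have "\<dots> = (\<Sum>l\<in>{..<d}. of_nat N ^ card (join (partition_lattice {1..2 * m})
        (pairing m (q i)) (pairing m (q l))) * weight_vector (x j) (q l))"
      using ij by (intro sum.cong refl) (simp add: G_def half_liberated_gram_def len P_def q(2))
    also have "\<dots> = (\<Sum>r\<in>?perms. of_nat N ^ card (join (partition_lattice {1..2 * m})
        (pairing m (q i)) (pairing m r)) * weight_vector (x j) r)"
      by (rule sum.reindex_bij_betw[OF bij_q])
    also have "\<dots> = ev (x j) * weight_vector (x j) (q i)" 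
      unfolding ev_def by (rule gram_weight_vector[OF xX[OF ij(2)] q(1)[OF ij(1)]])
    also have "\<dots> = (P * mat_diag d (\<lambda>j. ev (x j))) $$ (i, j)"
      unfolding mat_diag_mult_right[OF P] using ij by (simp add: P_def mult.commute)
    finally show "(G * P) $$ (i, j) = (P * mat_diag d (\<lambda>j. ev (x j))) $$ (i, j)" .
  qed (use G P in \<open>simp_all add: mat_diag_def\<close>)
  then have "det G * det P = det P * det (mat_diag d (\<lambda>j. ev (x j)))"
    using det_mult[OF G P] det_mult[OF P mat_diag_dim[of d]] by metis
  moreover have "det P \<noteq> 0"
  proof
    assume "det P = 0"
    then obtain u where u: "u \<in> carrier_vec d" "u \<noteq> 0\<^sub>v d" "P *\<^sub>v u = 0\<^sub>v d"
      using det_0_iff_vec_prod_zero_field[OF P] by blast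
    define w where "w z = u $ inv_into {..<d} x z" for z
    have wx: "w (x j) = u $ j" if "j < d" for j
      using bij_x that by (simp add: w_def bij_betw_def)
    have rel: "\<forall>p\<in>?perms. (\<Sum>z\<in>?X. w z * weight_vector z p) = 0"
    proof
      fix p assume "p \<in> ?perms"
      then obtain i where i: "i < d" "p = q i" using bij_q by (auto simp: bij_betw_def)
      have "(\<Sum>z\<in>?X. w z * weight_vector z p) = (\<Sum>j\<in>{..<d}. w (x j) * weight_vector (x j) p)"
        by (rule sum.reindex_bij_betw[OF bij_x, symmetric])
      also have "\<dots> = (P *\<^sub>v u) $ i"
        using u(1) i by (auto simp: scalar_prod_def P_def atLeast0LessThan wx mult.commute intro!: sum.cong)
      finally show "(\<Sum>z\<in>?X. w z * weight_vector z p) = 0" using u(3) i by simp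
    qed
    have "\<forall>z\<in>?X. w z = 0" using rel by (rule weight_vectors_independent)
    then have "u $ j = 0" if "j < d" for j using wx[OF that] xX[OF that] by simp
    then have "u = 0\<^sub>v d" using u(1) by (intro eq_vecI) auto
    then show False using u(2) by simp
  qed
  ultimately have "det G = det (mat_diag d (\<lambda>j. ev (x j)))" by simp
  also have "\<dots> = (\<Prod>j\<in>{..<d}. ev (x j))"
  proof -
    have "upper_triangular (mat_diag d (\<lambda>j. ev (x j)))" by (auto simp: mat_diag_def)
    then show ?thesis
      by (subst det_upper_triangular[OF _ mat_diag_dim])
        (auto simp: prod_list_diag_prod mat_diag_def atLeast0LessThan)
  qed
  also have "\<dots> = (\<Prod>z\<in>?X. ev z)" by (rule prod.reindex_bij_betw[OF bij_x])
  also have "\<dots> = (\<Prod>\<mu>\<in>young_diagrams m. \<Prod>ST\<in>SYT \<mu> \<times> SYT \<mu>. ev (\<mu>, ST))"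
  proof -
    have "(\<Prod>\<mu>\<in>young_diagrams m. \<Prod>ST\<in>SYT \<mu> \<times> SYT \<mu>. ev (\<mu>, ST)) = (\<Prod>(\<mu>, ST)\<in>?X. ev (\<mu>, ST))"
      unfolding tableau_pairs_def
      by (rule prod.Sigma[OF finite_young_diagrams_of_size])
        (auto simp: young_diagrams_def intro: finite_SYT)
    then show ?thesis by simp
  qed
  also have "\<dots> = (\<Prod>\<mu>\<in>young_diagrams m. content_product (of_nat N) \<mu> ^ (num_standard_tableaux \<mu>)\<^sup>2)"
    by (simp add: ev_def num_standard_tableaux_def card_cartesian_product power2_eq_square)
  finally show ?thesis by (simp add: G_def)
qed

lemma int_poly_eqI_nat:
  fixes f g :: "int poly"
  assumes "\<And>N :: nat. poly f (int N) = poly g (int N)"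
  shows "f = g"
proof (rule ccontr)
  assume "f \<noteq> g"
  then have "finite {z. poly (f - g) z = 0}" by (intro poly_roots_finite) simp
  moreover have "range int \<subseteq> {z. poly (f - g) z = 0}" using assms by auto
  ultimately have "finite (range int)" by (rule finite_subset[rotated])
  then show False using range_inj_infinite[of int] by simp
qed

theorem theorem4p3:
  fixes k :: nat and ps :: "nat set set list" and n :: "int poly"
  assumes n: "n = [:0, 1:]"
    and ps: "distinct ps" "set ps = odd_even_pairings k"
  shows "det (half_liberated_gram k n ps) =
    (\<Prod>\<mu> | young_diagram \<mu> \<and> 2 * card \<mu> = k.
       content_product n \<mu> ^ (num_standard_tableaux \<mu>)\<^sup>2)"
proof (cases "even k")
  case False
  then have "ps = []" using ps odd_even_pairings_odd by simp
  moreover have none: "{\<mu>. young_diagram \<mu> \<and> 2 * card \<mu> = k} = {}" using False by auto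
  ultimately show ?thesis unfolding none by (simp add: half_liberated_gram_def)
next
  case True
  then obtain m where k: "k = 2 * m" by (auto elim: evenE)
  have diagrams: "{\<mu>. young_diagram \<mu> \<and> 2 * card \<mu> = k} = young_diagrams m"
    by (auto simp: k young_diagrams_def)
  show ?thesis
    unfolding diagrams
  proof (rule int_poly_eqI_nat)
    fix N :: nat
    interpret ev: comm_ring_hom "\<lambda>f :: int poly. of_int (poly f (int N)) :: rat"
      by unfold_locales simp_all
    have gram: "map_mat (\<lambda>f. of_int (poly f (int N))) (half_liberated_gram k n ps) =
        half_liberated_gram k (of_nat N :: rat) ps"
      by (rule eq_matI) (auto simp: half_liberated_gram_def n)
    have eval_product: "of_int (poly (content_product n \<mu>) (int N)) = (content_product (of_nat N) \<mu> :: rat)" for \<mu>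
      unfolding content_product_def ev.hom_prod by (rule prod.cong) (auto simp: n)
    have "(of_int (poly (det (half_liberated_gram k n ps)) (int N)) :: rat) =
        det (half_liberated_gram k (of_nat N) ps)"
      unfolding gram[symmetric] ev.hom_det ..
    also have "\<dots> = (\<Prod>\<mu>\<in>young_diagrams m. content_product (of_nat N) \<mu> ^ (num_standard_tableaux \<mu>)\<^sup>2)"
      using ps unfolding k by (rule det_gram_of_nat)
    also have "\<dots> = of_int (poly (\<Prod>\<mu>\<in>young_diagrams m. content_product n \<mu> ^ (num_standard_tableaux \<mu>)\<^sup>2) (int N))"
      unfolding ev.hom_prod ev.hom_power eval_product ..
    finally show "poly (det (half_liberated_gram k n ps)) (int N) =
        poly (\<Prod>\<mu>\<in>young_diagrams m. content_product n \<mu> ^ (num_standard_tableaux \<mu>)\<^sup>2) (int N)"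
      by (simp only: of_int_eq_iff)
  qed
qed

end
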